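(* Let $\mathbb{K}$ be a field, let $G$ be a graph with vertex set $\{v_1,\dots,v_n\}$, and let $I=I(G)\subseteq S=\mathbb{K}[x_1,\dots,x_n]$ be its edge ideal. Assume that $G$ has $p$ bipartite connected components and suppose that at least one of the connected components of $G$ is a tree with at least one edge. Then for every integer $k\geq 1$, we have $\mathrm{sdepth}(I^k)\geq p+1$.
   Context: Graphs are finite and simple. A tree is a connected graph with no cycle. The edge ideal $I(G)$ is the ideal of $S=\mathbb{K}[x_1,\dots,x_n]$ generated by the squarefree monomials $x_ix_j$ with $\{v_i,v_j\}$ an edge of $G$. An isolated vertex counts as a bipartite connected component. Stanley depth: let $M$ be a finitely generated $\mathbb{Z}^n$-graded $S$-module, $u\in M$ a homogeneous element and $Z\subseteq\{x_1,\dots,x_n\}$. The $\mathbb{K}$-subspace $u\mathbb{K}[Z]$ generated by all $uv$ with $v\in\mathbb{K}[Z]$ is called a Stanley space of dimension $|Z|$ if it is a free $\mathbb{K}[Z]$-module. A Stanley decomposition $\mathcal{D}$ of $M$ is a decomposition of $M$ (as a $\mathbb{K}$-vector space) as a finite direct sum of Stanley spaces; $\mathrm{sdepth}(\mathcal{D})$ is the minimum dimension of a Stanley space in $\mathcal{D}$, and $\mathrm{sdepth}(M)$ is the maximum of $\mathrm{sdepth}(\mathcal{D})$ over all Stanley decompositions $\mathcal{D}$ of $M$. *)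

theory Defs
  imports Complex_Main "HOL-Library.FuncSet" "HOL-Library.Poly_Mapping"
begin

definition simple_graph :: "'v set \<Rightarrow> 'v set set \<Rightarrow> bool" where
  "simple_graph V E \<longleftrightarrow> finite V \<and> (\<forall>e\<in>E. e \<subseteq> V \<and> card e = 2)"

definition adj :: "'v set set \<Rightarrow> 'v rel" where
  "adj E = {(u, w). {u, w} \<in> E}"

definition induced_edges :: "'v set \<Rightarrow> 'v set set \<Rightarrow> 'v set set" where
  "induced_edges C E = {e \<in> E. e \<subseteq> C}"

definition connected_graph :: "'v set \<Rightarrow> 'v set set \<Rightarrow> bool" where
  "connected_graph V E \<longleftrightarrow> V \<noteq> {} \<and> (\<forall>u\<in>V. \<forall>w\<in>V. (u, w) \<in> (adj E)\<^sup>*)"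

definition components :: "'v set \<Rightarrow> 'v set set \<Rightarrow> 'v set set" where
  "components V E = V // {(u, w). u \<in> V \<and> w \<in> V \<and> (u, w) \<in> (adj E)\<^sup>*}"

definition bipartite_graph :: "'v set \<Rightarrow> 'v set set \<Rightarrow> bool" where
  "bipartite_graph V E \<longleftrightarrow>
     (\<exists>A B. A \<union> B = V \<and> A \<inter> B = {} \<and> (\<forall>e\<in>E. \<exists>a\<in>A. \<exists>b\<in>B. e = {a, b}))"

definition is_cycle :: "'v set set \<Rightarrow> 'v list \<Rightarrow> bool" where
  "is_cycle E vs \<longleftrightarrow> length vs \<ge> 3 \<and> distinct vs \<and>
     (\<forall>i<length vs. {vs ! i, vs ! (Suc i mod length vs)} \<in> E)"

definition tree_graph :: "'v set \<Rightarrow> 'v set set \<Rightarrow> bool" where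
  "tree_graph V E \<longleftrightarrow> connected_graph V E \<and> \<not> (\<exists>vs. is_cycle E vs)"

text \<open>The variables are indexed by the type \<^typ>\<open>'v\<close>; an element of \<open>'v \<Rightarrow>\<^sub>0 nat\<close> is the
  exponent vector of a monomial.\<close>

type_synonym ('v, 'k) mpoly = "('v \<Rightarrow>\<^sub>0 nat) \<Rightarrow>\<^sub>0 'k"

definition var :: "'v \<Rightarrow> ('v, 'k::field) mpoly" where
  "var i = Poly_Mapping.single (Poly_Mapping.single i 1) 1"

definition polys_in :: "'v set \<Rightarrow> ('v, 'k::field) mpoly set" where
  "polys_in Z = {f. \<forall>b\<in>Poly_Mapping.keys f. Poly_Mapping.keys b \<subseteq> Z}"

text \<open>The ideals are the submodules of the ring over itself.\<close>

definition ideal_gen :: "'a::comm_ring_1 set \<Rightarrow> 'a set" where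
  "ideal_gen B = module.span (*) B"

primrec ideal_power :: "'a::comm_ring_1 set \<Rightarrow> nat \<Rightarrow> 'a set" where
  "ideal_power I 0 = UNIV"
| "ideal_power I (Suc k) = ideal_gen {f * g |f g. f \<in> I \<and> g \<in> ideal_power I k}"

definition edge_ideal :: "'v set set \<Rightarrow> ('v, 'k::field) mpoly set" where
  "edge_ideal E = ideal_gen {var i * var j |i j. {i, j} \<in> E}"

text \<open>A multigraded module over the polynomial ring is given by a scalar multiplication
  \<open>scale\<close> on an ambient group, the homogeneous components \<open>gr a\<close> of that ambient module for
  \<open>a \<in> \<int>\<^sup>n\<close> (functions from the variables to the integers), and a carrier \<open>M\<close>, which is a graded
  submodule of the ambient module, so that its components are \<open>M \<inter> gr a\<close>.\<close>

text \<open>The component of degree \<open>a\<close> of the polynomial ring itself; it is \<open>{0}\<close> unless \<open>a \<ge> 0\<close>.\<close>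

definition poly_component :: "('v \<Rightarrow> int) \<Rightarrow> ('v, 'k::field) mpoly set" where
  "poly_component a = {f. \<forall>b\<in>Poly_Mapping.keys f. \<forall>i. int (Poly_Mapping.lookup b i) = a i}"

text \<open>Freeness of \<open>N\<close> over a subring \<open>R\<close> of the scalars: existence of a basis \<open>B\<close>, where the
  coefficient families of finite support are finitely supported functions.\<close>

definition free_over :: "('r::comm_ring_1 \<Rightarrow> 'm \<Rightarrow> 'm::ab_group_add) \<Rightarrow> 'r set \<Rightarrow> 'm set \<Rightarrow> bool" where
  "free_over scale R N \<longleftrightarrow> (\<exists>B\<subseteq>N. \<forall>m\<in>N. \<exists>!c :: 'm \<Rightarrow>\<^sub>0 'r.
     Poly_Mapping.keys c \<subseteq> B \<and> range (Poly_Mapping.lookup c) \<subseteq> R \<and>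
     m = (\<Sum>b\<in>Poly_Mapping.keys c. scale (Poly_Mapping.lookup c b) b))"

definition stanley_subspace ::
  "(('v, 'k::field) mpoly \<Rightarrow> 'm \<Rightarrow> 'm) \<Rightarrow> 'm \<times> 'v set \<Rightarrow> 'm set" where
  "stanley_subspace scale d = (\<lambda>f. scale f (fst d)) ` polys_in (snd d)"

text \<open>For \<open>fst d = 0\<close> the space is zero, hence free on the empty basis. Such summands can only
  lower the minimum in the Stanley depth of a decomposition, so for \<open>M \<noteq> {0}\<close> they do not affect
  the maximum.\<close>

definition is_stanley_space ::
  "(('v, 'k::field) mpoly \<Rightarrow> 'm \<Rightarrow> 'm::ab_group_add) \<Rightarrow> (('v \<Rightarrow> int) \<Rightarrow> 'm set) \<Rightarrow> 'm set \<Rightarrow>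
   'm \<times> 'v set \<Rightarrow> bool" where
  "is_stanley_space scale gr M d \<longleftrightarrow> fst d \<in> M \<and> (\<exists>a. fst d \<in> gr a) \<and>
     free_over scale (polys_in (snd d)) (stanley_subspace scale d)"

text \<open>The bijectivity condition says that \<open>M\<close> is the internal direct sum of the spaces.\<close>

definition stanley_decomposition ::
  "(('v, 'k::field) mpoly \<Rightarrow> 'm \<Rightarrow> 'm::ab_group_add) \<Rightarrow> (('v \<Rightarrow> int) \<Rightarrow> 'm set) \<Rightarrow> 'm set \<Rightarrow>
   ('m \<times> 'v set) set \<Rightarrow> bool" where
  "stanley_decomposition scale gr M D \<longleftrightarrow> finite D \<and> (\<forall>d\<in>D. is_stanley_space scale gr M d) \<and>
     bij_betw (\<lambda>m. \<Sum>d\<in>D. m d) (Pi\<^sub>E D (stanley_subspace scale)) M"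

definition sdepth_decomposition :: "('m \<times> 'v set) set \<Rightarrow> nat" where
  "sdepth_decomposition D = Min ((\<lambda>d. card (snd d)) ` D)"

text \<open>Only meaningful for \<open>M \<noteq> {0}\<close>: then every decomposition is nonempty, and for finitely many
  variables the maximum is over a bounded set.\<close>

definition sdepth ::
  "(('v, 'k::field) mpoly \<Rightarrow> 'm \<Rightarrow> 'm::ab_group_add) \<Rightarrow> (('v \<Rightarrow> int) \<Rightarrow> 'm set) \<Rightarrow> 'm set \<Rightarrow> nat" where
  "sdepth scale gr M = Max (sdepth_decomposition ` {D. stanley_decomposition scale gr M D})"

end

(* Let nu E u be the largest size of a matching of the graph in which each vertex v is used at most
u(v) times. Then x^u lies in I^k iff k <= nu E u, so a Stanley decomposition of I^k may be read off
from a partition of {u. k <= nu E u} into finitely many translated coordinate orthants.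

Since nu is additive over vertex-disjoint parts, {nu >= k} for a union of two parts is the disjoint
union of the products {nu_1 >= k - j} x {nu_2 = j}, j < k, and {all} x {nu_2 >= k}; dimensions of
orthants add. So it is enough to get
  - orthants of dimension >= 1 for {nu = k} and {nu >= k} on every bipartite component: for {nu = k},
    a cover of minimum weight (weighted Koenig theorem) misses some vertex i, and increasing u at i
    leaves nu unchanged, so that u can be moved along a ray in direction i;
  - orthants of dimension >= 2 for {nu >= k} on the tree: if x is a leaf with neighbour y, then
    split according to whether xy divides the monomial (where (I^k : xy) = I^(k-1)), x does not
    divide it, or x does but y does not, and induct.
The tree together with the other bipartite components then contributes at least 2 + (p - 1). *)
theory Submission
  imports Defs "HOL-Library.Disjoint_Sets"
begin

subsection \<open>Matchings with vertex capacities\<close>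

text \<open>In a union of two parts, exact levels of \<open>nu\<close> are needed on one side only,
  and this asymmetry is forced. For a single edge, \<open>nu\<close> is the minimum of two
  exponents, so {nu = k} contains no orthant of dimension 2, whereas {nu >= k} is one; hence the
  tree has to be the part from which only up-sets are taken. Bipartiteness serves the exact levels:
  in a triangle with all capacities 1, raising any capacity raises \<open>nu\<close> from 1 to 2, so
  this point lies on no ray inside {nu = 1}. The vertices of non-bipartite components are therefore
  counted with dimension 0. The vertex along which u can be moved depends on u (for one edge it is
  an endpoint with the larger exponent), so the directions must be chosen consistently for the rays
  to be disjoint. Finiteness of the partitions comes from cutting off exponents: a matching of size
  k uses no vertex more than k times, so whether nu >= k holds depends only on the exponents
  truncated at k.\<close>

definition matchable :: "'v set set \<Rightarrow> nat \<Rightarrow> ('v \<Rightarrow> nat) \<Rightarrow> bool" where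
  "matchable E k u \<longleftrightarrow>
     (\<exists>f. sum f E = k \<and> (\<forall>v. sum f {e \<in> E. v \<in> e} \<le> u v))"

text \<open>An edge \<open>{}\<close> would consume no capacity and could be repeated without limit,
  leaving no greatest \<open>k\<close>; hence the hypothesis \<open>{} \<notin> E\<close> in what
  follows.\<close>

definition nu :: "'v set set \<Rightarrow> ('v \<Rightarrow> nat) \<Rightarrow> nat" where
  "nu E u = (GREATEST k. matchable E k u)"

lemma sum_dec:
  fixes f :: "'a \<Rightarrow> nat"
  assumes "finite S" "f e > 0"
  shows "sum (f(e := f e - Suc 0)) S = sum f S - of_bool (e \<in> S)"
proof (cases "e \<in> S")
  case True
  then have "sum (f(e := f e - Suc 0)) S = f e - 1 + sum f (S - {e})"
    using assms(1) by (subst sum.remove[of S e]) (auto intro: sum.cong)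
  then show ?thesis using sum.remove[OF assms(1) True, of f] True assms(2) by simp
next
  case False
  then show ?thesis by (auto intro!: sum.cong)
qed

lemma sum_inc:
  fixes f :: "'a \<Rightarrow> nat"
  assumes "finite S"
  shows "sum (f(e := Suc (f e))) S = sum f S + of_bool (e \<in> S)"
proof (cases "e \<in> S")
  case True
  then have "sum (f(e := Suc (f e))) S = Suc (f e) + sum f (S - {e})"
    using assms by (subst sum.remove[of S e]) (auto intro: sum.cong)
  then show ?thesis using sum.remove[OF assms True, of f] True by simp
next
  case False
  then show ?thesis by (auto intro!: sum.cong)
qed

lemma matchable_antimono:
  assumes "finite E" "matchable E k u" "j \<le> k"
  shows "matchable E j u"
  using assms(3,2)
proof (induction rule: inc_induct)
  case (step n)
  then obtain f where f: "sum f E = Suc n" "\<And>v. sum f {e \<in> E. v \<in> e} \<le> u v"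
    by (auto simp: matchable_def)
  obtain e where e: "e \<in> E" "f e > 0"
  proof (rule ccontr)
    assume "\<not> thesis"
    then have "sum f E = 0" using that by (intro sum.neutral) auto
    then show False using f(1) by simp
  qed
  have "sum (f(e := f e - 1)) E = n" using f e assms(1) by (simp add: sum_dec del: fun_upd_apply)
  moreover have "sum (f(e := f e - 1)) {e \<in> E. v \<in> e} \<le> u v" for v
    using f(2)[of v] e assms(1) by (simp add: sum_dec del: fun_upd_apply)
  ultimately show ?case unfolding matchable_def by blast
qed

text \<open>Weak duality of matchings and vertex covers: every edge is counted at least once among
  its vertices in \<open>W\<close>, and exchanging the two sums leaves the loads at the vertices of
  \<open>W\<close>.\<close>

lemma sum_le_cover:
  fixes f :: "'v set \<Rightarrow> nat"
  assumes "finite E" "finite W" "\<And>e. e \<in> E \<Longrightarrow> e \<inter> W \<noteq> {}"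
    and "\<And>v. v \<in> W \<Longrightarrow> sum f {e \<in> E. v \<in> e} \<le> u v"
  shows "sum f E \<le> sum u W"
proof -
  have "sum f E \<le> (\<Sum>e\<in>E. \<Sum>v\<in>{v\<in>W. v \<in> e}. f e)"
  proof (rule sum_mono)
    fix e assume "e \<in> E"
    then have "card {v\<in>W. v \<in> e} > 0" using assms(2,3) by (auto simp: card_gt_0_iff)
    then show "f e \<le> (\<Sum>v\<in>{v\<in>W. v \<in> e}. f e)" by simp
  qed
  also have "\<dots> = (\<Sum>v\<in>W. sum f {e \<in> E. v \<in> e})"
    using assms(1,2) by (rule sum.swap_restrict)
  also have "\<dots> \<le> sum u W" using assms(4) by (rule sum_mono)
  finally show ?thesis .
qed

lemma le_nu_iff:
  assumes "finite E" "{} \<notin> E"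
  shows "k \<le> nu E u \<longleftrightarrow> matchable E k u"
proof -
  \<comment> \<open>One vertex of each edge: a finite cover, whose weight bounds all matchings, so
    that the greatest size exists.\<close>
  define W where "W = (\<lambda>e. SOME v. v \<in> e) ` E"
  have cov: "e \<inter> W \<noteq> {}" if "e \<in> E" for e
    using that assms(2) some_in_eq[of e] unfolding W_def by (metis disjoint_iff imageI)
  have bd: "j \<le> sum u W" if "matchable E j u" for j
    using that sum_le_cover[OF assms(1) _ cov] assms(1)
    unfolding matchable_def W_def by blast
  have "matchable E 0 u" unfolding matchable_def by (rule exI[of _ "\<lambda>_. 0"]) simp
  then have "matchable E (nu E u) u"
    unfolding nu_def using bd by (rule GreatestI_nat)
  moreover have "k \<le> nu E u" if "matchable E k u"
    unfolding nu_def using that bd by (rule Greatest_le_nat)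
  ultimately show ?thesis using matchable_antimono[OF assms(1)] by blast
qed

lemma nu_mono:
  assumes "finite E" "{} \<notin> E" "\<And>v. v \<in> \<Union>E \<Longrightarrow> u v \<le> w v"
  shows "nu E u \<le> nu E w"
proof -
  have "matchable E (nu E u) u" using le_nu_iff assms(1,2) by blast
  then obtain f where f: "sum f E = nu E u" "\<And>v. sum f {e \<in> E. v \<in> e} \<le> u v"
    by (auto simp: matchable_def)
  have "sum f {e \<in> E. v \<in> e} \<le> w v" for v
  proof (cases "v \<in> \<Union>E")
    case False
    then have "{e \<in> E. v \<in> e} = {}" by auto
    then show ?thesis by (metis sum.empty zero_le)
  qed (use f(2) assms(3) le_trans in blast)
  then show ?thesis using f(1) le_nu_iff[OF assms(1,2)] unfolding matchable_def by blast
qed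

lemma nu_cong:
  assumes "finite E" "{} \<notin> E" "\<And>v. v \<in> \<Union>E \<Longrightarrow> u v = w v"
  shows "nu E u = nu E w"
  using nu_mono[OF assms(1,2), of u w] nu_mono[OF assms(1,2), of w u] assms(3)
  by (simp add: le_antisym)

text \<open>The load of a vertex in a matching of size \<open>k\<close> is at most \<open>k\<close>,
  so capacities beyond \<open>N\<close> never bind. This is the source of all finiteness in the
  partitions below.\<close>

lemma nu_min:
  assumes "finite E" "{} \<notin> E" "k \<le> N"
  shows "k \<le> nu E (\<lambda>v. min (u v) N) \<longleftrightarrow> k \<le> nu E u"
proof
  assume "k \<le> nu E u"
  then obtain f where f: "sum f E = k" "\<And>v. sum f {e \<in> E. v \<in> e} \<le> u v"
    using le_nu_iff[OF assms(1,2)] by (auto simp: matchable_def)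
  have "sum f {e \<in> E. v \<in> e} \<le> sum f E" for v
    using assms(1) by (intro sum_mono2) auto
  then have "\<forall>v. sum f {e \<in> E. v \<in> e} \<le> min (u v) N"
    using f assms(3) by (metis le_trans min.bounded_iff)
  then show "k \<le> nu E (\<lambda>v. min (u v) N)"
    using le_nu_iff[OF assms(1,2)] f(1) unfolding matchable_def by blast
next
  assume "k \<le> nu E (\<lambda>v. min (u v) N)"
  also have "\<dots> \<le> nu E u" by (intro nu_mono assms) simp
  finally show "k \<le> nu E u" .
qed

lemma nu_truncate:
  assumes "finite E" "{} \<notin> E" "k \<le> N" "\<And>v. v \<in> \<Union>E \<Longrightarrow> min (u v) N = min (w v) N"
  shows "k \<le> nu E u \<longleftrightarrow> k \<le> nu E w"
  using nu_cong[OF assms(1,2,4)] nu_min[OF assms(1-3), of u] nu_min[OF assms(1-3), of w] by simp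

lemma nu_cover:
  assumes "finite E" "{} \<notin> E" "finite W" "\<And>e. e \<in> E \<Longrightarrow> e \<inter> W \<noteq> {}"
  shows "nu E u \<le> sum u W"
proof -
  obtain f where "sum f E = nu E u" "\<And>v. sum f {e \<in> E. v \<in> e} \<le> u v"
    using le_nu_iff[OF assms(1,2), of "nu E u" u] by (auto simp: matchable_def)
  then show ?thesis using sum_le_cover[OF assms(1,3,4), of f u] by simp
qed

lemma nu_subset:
  assumes "finite E" "{} \<notin> E" "F \<subseteq> E"
  shows "nu F u \<le> nu E u"
proof -
  have F: "finite F" "{} \<notin> F" using assms finite_subset by auto
  obtain f where f: "sum f F = nu F u" "\<And>v. sum f {e \<in> F. v \<in> e} \<le> u v"
    using le_nu_iff[OF F, of "nu F u" u] by (auto simp: matchable_def)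
  have eq: "sum (\<lambda>e. if e \<in> F then f e else 0) X = sum f (X \<inter> F)" if "X \<subseteq> E" for X
    using that assms(1) by (simp add: finite_subset sum.inter_restrict)
  have "E \<inter> F = F" "{e \<in> E. v \<in> e} \<inter> F = {e \<in> F. v \<in> e}" for v using assms(3) by auto
  then have "matchable E (nu F u) u"
    unfolding matchable_def using f by (intro exI[of _ "\<lambda>e. if e \<in> F then f e else 0"]) (simp add: eq)
  then show ?thesis using le_nu_iff[OF assms(1,2)] by blast
qed

text \<open>A matching of the union restricts to both parts, and matchings of the parts can be glued
  because no vertex meets edges of both.\<close>

lemma nu_Un:
  assumes "finite E" "{} \<notin> E" "finite F" "{} \<notin> F" "\<Union>E \<inter> \<Union>F = {}"
  shows "nu (E \<union> F) u = nu E u + nu F u"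
proof (rule antisym)
  have EF: "finite (E \<union> F)" "{} \<notin> E \<union> F" using assms by auto
  have dis: "E \<inter> F = {}"
  proof (rule ccontr)
    assume "E \<inter> F \<noteq> {}"
    then obtain e where "e \<in> E" "e \<in> F" by blast
    moreover from this obtain v where "v \<in> e" using assms(2) by (cases "e = {}") auto
    ultimately show False using assms(5) by blast
  qed
  have inE: "v \<notin> e" if "v \<in> e'" "e' \<in> F" "e \<in> E" for v e e' using that assms(5) by auto
  obtain f where f: "sum f (E \<union> F) = nu (E \<union> F) u" "\<And>v. sum f {e \<in> E \<union> F. v \<in> e} \<le> u v"
    using le_nu_iff[OF EF, of "nu (E \<union> F) u" u] by (auto simp: matchable_def)
  have "sum f {e \<in> E. v \<in> e} \<le> u v" "sum f {e \<in> F. v \<in> e} \<le> u v" for v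
    using f(2)[of v] assms(1,3)
    by (auto intro!: order.trans[OF sum_mono2 f(2)[of v]])
  then have "matchable E (sum f E) u" "matchable F (sum f F) u"
    unfolding matchable_def by blast+
  then have "sum f E \<le> nu E u" "sum f F \<le> nu F u" using le_nu_iff assms by blast+
  then show "nu (E \<union> F) u \<le> nu E u + nu F u"
    using f(1) sum.union_disjoint[OF assms(1,3) dis, of f] by simp
  obtain g where g: "sum g E = nu E u" "\<And>v. sum g {e \<in> E. v \<in> e} \<le> u v"
    using le_nu_iff[OF assms(1,2), of "nu E u" u] by (auto simp: matchable_def)
  obtain h where h: "sum h F = nu F u" "\<And>v. sum h {e \<in> F. v \<in> e} \<le> u v"
    using le_nu_iff[OF assms(3,4), of "nu F u" u] by (auto simp: matchable_def)
  define gh where "gh e = (if e \<in> E then g e else h e)" for e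
  have E': "sum gh X = sum g X" if "X \<subseteq> E" for X
    using that by (intro sum.cong) (auto simp: gh_def)
  have F': "sum gh X = sum h X" if "X \<subseteq> F" for X
    using that dis by (intro sum.cong) (auto simp: gh_def)
  have "sum gh (E \<union> F) = nu E u + nu F u"
    using sum.union_disjoint[OF assms(1,3) dis, of gh] g(1) h(1) E' F' by simp
  moreover have "sum gh {e \<in> E \<union> F. v \<in> e} \<le> u v" for v
  proof (cases "v \<in> \<Union>E")
    case True
    then have "{e \<in> E \<union> F. v \<in> e} = {e \<in> E. v \<in> e}" using inE by blast
    then show ?thesis using g(2)[of v] E' by (metis (no_types, lifting) mem_Collect_eq subsetI)
  next
    case False
    then have "{e \<in> E \<union> F. v \<in> e} = {e \<in> F. v \<in> e}" by blast
    then show ?thesis using h(2)[of v] F' by (metis (no_types, lifting) mem_Collect_eq subsetI)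
  qed
  ultimately show "nu E u + nu F u \<le> nu (E \<union> F) u"
    using le_nu_iff[OF EF] unfolding matchable_def by blast
qed

lemma nu_add:
  assumes "finite E" "{} \<notin> E"
  shows "nu E u + nu E w \<le> nu E (\<lambda>v. u v + w v)"
proof -
  obtain f where f: "sum f E = nu E u" "\<And>v. sum f {e \<in> E. v \<in> e} \<le> u v"
    using le_nu_iff[OF assms, of "nu E u" u] by (auto simp: matchable_def)
  obtain g where g: "sum g E = nu E w" "\<And>v. sum g {e \<in> E. v \<in> e} \<le> w v"
    using le_nu_iff[OF assms, of "nu E w" w] by (auto simp: matchable_def)
  have "matchable E (nu E u + nu E w) (\<lambda>v. u v + w v)"
    unfolding matchable_def using f g
    by (intro exI[of _ "\<lambda>e. f e + g e"]) (simp add: sum.distrib add_mono)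
  then show ?thesis using le_nu_iff[OF assms] by blast
qed

lemma nu_add_edge:
  assumes "finite E" "{} \<notin> E" "e \<in> E"
  shows "nu E u + 1 \<le> nu E (\<lambda>v. u v + of_bool (v \<in> e))"
proof -
  obtain f where f: "sum f E = nu E u" "\<And>v. sum f {e \<in> E. v \<in> e} \<le> u v"
    using le_nu_iff[OF assms(1,2), of "nu E u" u] by (auto simp: matchable_def)
  have "matchable E (nu E u + 1) (\<lambda>v. u v + of_bool (v \<in> e))"
    unfolding matchable_def using f assms
    by (intro exI[of _ "f(e := f e + 1)"]) (simp add: sum_inc del: fun_upd_apply)
  then show ?thesis using le_nu_iff[OF assms(1,2)] by blast
qed

text \<open>Taking one copy of a used edge out of a matching; on monomials this says that I^(k+1) is
  contained in I * I^k.\<close>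

lemma nu_add_edge_cases:
  assumes "finite E" "{} \<notin> E" "Suc k \<le> nu E u"
  obtains e where "e \<in> E" "\<And>v. v \<in> e \<Longrightarrow> 1 \<le> u v" "k \<le> nu E (\<lambda>v. u v - of_bool (v \<in> e))"
proof -
  obtain f where f: "sum f E = Suc k" "\<And>v. sum f {e \<in> E. v \<in> e} \<le> u v"
    using le_nu_iff[OF assms(1,2), of "Suc k" u] assms(3) by (auto simp: matchable_def)
  obtain e where e: "e \<in> E" "f e > 0"
  proof (rule ccontr)
    assume "\<not> thesis"
    then have "sum f E = 0" using that by (intro sum.neutral) auto
    then show False using f(1) by simp
  qed
  have "sum (f(e := f e - 1)) E = k" using f e assms(1) by (simp add: sum_dec del: fun_upd_apply)
  moreover have "sum (f(e := f e - 1)) {e \<in> E. v \<in> e} \<le> u v - of_bool (v \<in> e)" for v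
    using f(2)[of v] e assms(1) by (auto simp: sum_dec simp del: fun_upd_apply)
  ultimately have "matchable E k (\<lambda>v. u v - of_bool (v \<in> e))" unfolding matchable_def by blast
  moreover have "1 \<le> u v" if "v \<in> e" for v
  proof -
    have "f e \<le> sum f {e \<in> E. v \<in> e}" using that e assms(1) by (intro member_le_sum) auto
    then show ?thesis using f(2)[of v] e(2) by linarith
  qed
  ultimately show ?thesis using that e(1) le_nu_iff[OF assms(1,2)] by blast
qed

lemma nu_leaf_edge:
  assumes "finite E" "{} \<notin> E" "{x, y} \<in> E" "\<And>e. e \<in> E \<Longrightarrow> x \<in> e \<Longrightarrow> e = {x, y}"
  shows "nu E (\<lambda>v. u v + of_bool (v \<in> {x, y})) = nu E u + 1"
proof (rule antisym)
  let ?w = "\<lambda>v. u v + of_bool (v \<in> {x, y})"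
  define n where "n = nu E ?w"
  obtain f where f: "sum f E = n" "\<And>v. sum f {e \<in> E. v \<in> e} \<le> ?w v"
    using le_nu_iff[OF assms(1,2), of n ?w] by (auto simp: matchable_def n_def)
  \<comment> \<open>If \<open>f\<close> exceeds \<open>u\<close> only on the vertices of a used edge
    \<open>e\<close>, and there by at most one, dropping one copy of \<open>e\<close> repairs
    it.\<close>
  have dec: "n \<le> nu E u + 1"
    if "e \<in> E" "f e > 0" "\<And>v. sum f {e \<in> E. v \<in> e} \<le> u v + of_bool (v \<in> e)" for e
  proof -
    have "sum (f(e := f e - 1)) E = n - 1"
      using f that assms(1) by (simp add: sum_dec del: fun_upd_apply)
    moreover have "sum (f(e := f e - 1)) {e \<in> E. v \<in> e} \<le> u v" for v
      using that(3)[of v] that(1,2) assms(1) by (auto simp: sum_dec simp del: fun_upd_apply)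
    ultimately have "matchable E (n - 1) u" unfolding matchable_def by blast
    then show ?thesis using le_nu_iff[OF assms(1,2), of "n - 1" u] by linarith
  qed
  have ex: "sum f {e \<in> E. x \<in> e} = f {x, y}"
  proof -
    have "{e \<in> E. x \<in> e} = {{x, y}}" using assms(3,4) by blast
    then show ?thesis by simp
  qed
  show "n \<le> nu E u + 1"
  proof (cases "f {x, y} > 0")
    case True
    then show ?thesis using dec assms(3) f(2) by blast
  next
    case x0: False
    show ?thesis
    proof (cases "\<exists>e\<in>E. y \<in> e \<and> f e > 0")
      case True
      then obtain e where e: "e \<in> E" "y \<in> e" "f e > 0" by blast
      show ?thesis
      proof (rule dec[OF e(1,3)])
        fix v show "sum f {e \<in> E. v \<in> e} \<le> u v + of_bool (v \<in> e)"
          using f(2)[of v] ex x0 e(2) by (cases "v = x"; cases "v = y") auto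
      qed
    next
      case False
      then have "sum f {e \<in> E. y \<in> e} = 0" by auto
      then have "sum f {e \<in> E. v \<in> e} \<le> u v" for v
        using f(2)[of v] ex x0 by (cases "v = x"; cases "v = y") auto
      then have "matchable E n u" using f(1) unfolding matchable_def by blast
      then show ?thesis using le_nu_iff[OF assms(1,2), of n u] by linarith
    qed
  qed
qed (use nu_add_edge[OF assms(1-3)] in simp)

lemma nu_delete_vertex:
  assumes "finite E" "{} \<notin> E" "u x = 0"
  shows "nu E u = nu {e \<in> E. x \<notin> e} u"
proof (rule antisym)
  let ?F = "{e \<in> E. x \<notin> e}"
  obtain f where f: "sum f E = nu E u" "\<And>v. sum f {e \<in> E. v \<in> e} \<le> u v"
    using le_nu_iff[OF assms(1,2), of "nu E u" u] by (auto simp: matchable_def)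
  have "sum f {e \<in> E. x \<in> e} = 0" using f(2)[of x] assms(3) by simp
  then have z: "f e = 0" if "e \<in> E" "x \<in> e" for e using that assms(1) by auto
  have "sum f ?F = nu E u"
    unfolding f(1)[symmetric] by (rule sum.mono_neutral_left) (use assms(1) z in auto)
  moreover have "sum f {e \<in> ?F. v \<in> e} \<le> u v" for v
    using assms(1) by (intro order.trans[OF sum_mono2 f(2)[of v]]) auto
  ultimately have "matchable ?F (nu E u) u" unfolding matchable_def by blast
  then show "nu E u \<le> nu ?F u" using le_nu_iff[of ?F] assms(1,2) by simp
qed (use nu_subset[OF assms(1,2)] in auto)

section \<open>The weighted Koenig theorem and vertices that leave \<open>nu\<close>
  unchanged\<close>

lemma sum_add_indicator_pair:
  fixes w :: "'a \<Rightarrow> nat"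
  assumes "finite W" "a \<noteq> b"
  shows "(\<Sum>v\<in>W. w v + of_bool (v \<in> {a, b})) = sum w W + of_bool (a \<in> W) + of_bool (b \<in> W)"
proof -
  have "(\<Sum>v\<in>W. w v + of_bool (v \<in> {a, b}))
      = (\<Sum>v\<in>W. w v + ((if v = a then 1 else 0) + (if v = b then 1 else 0)))"
    using assms(2) by (intro sum.cong) auto
  also have "\<dots> = sum w W + ((if a \<in> W then 1 else 0) + (if b \<in> W then 1 else 0))"
    using assms(1) by (simp only: sum.distrib sum.delta)
  finally show ?thesis by simp
qed

text \<open>For an edge \<open>e\<close> with positive capacities, lowering the capacities on \<open>e\<close> yields a cover \<open>W1\<close> of
  weight at most \<open>nu E u + 1\<close>, and deleting \<open>e\<close> yields a cover \<open>W2\<close> of the other edges of weight at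
  most \<open>nu E u\<close>. If neither suffices, uncrossing the two along the bipartition gives covers \<open>P\<close>, \<open>Q\<close>
  of total weight at most \<open>2 * nu E u + 1\<close>.\<close>

lemma konig:
  assumes "finite V" "finite E" "\<Union>E \<subseteq> V" "A \<inter> B = {}"
    and "\<And>e. e \<in> E \<Longrightarrow> \<exists>a\<in>A. \<exists>b\<in>B. e = {a, b}"
  shows "\<exists>W\<subseteq>V. (\<forall>e\<in>E. e \<inter> W \<noteq> {}) \<and> sum u W \<le> nu E u"
  using assms(2,3,5)
\<comment> \<open>This measure drops both when the capacities on an edge are lowered and when the
  edge is deleted.\<close>
proof (induction "card E + sum u V" arbitrary: E u rule: less_induct)
  case less
  have ne: "{} \<notin> E" using less.prems(3) by blast
  show ?case
  proof (cases "\<exists>e\<in>E. \<forall>v\<in>e. u v > 0")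
    case False
    \<comment> \<open>Every edge has a vertex of capacity 0, so these vertices form a cover of
      weight 0.\<close>
    then show ?thesis
      using less.prems(2) by (intro exI[of _ "{v\<in>V. u v = 0}"]) fastforce
  next
    case True
    then obtain e where e: "e \<in> E" "\<And>v. v \<in> e \<Longrightarrow> u v > 0" by blast
    then obtain a b where ab: "a \<in> A" "b \<in> B" "e = {a, b}" using less.prems(3) by blast
    have abne: "a \<noteq> b" and abV: "a \<in> V" "b \<in> V" using ab assms(4) e(1) less.prems(2) by auto
    define w where "w v = u v - of_bool (v \<in> e)" for v
    have uw: "u v = w v + of_bool (v \<in> e)" for v using e(2)[of v] by (auto simp: w_def)
    have su: "sum u W = sum w W + of_bool (a \<in> W) + of_bool (b \<in> W)" if "W \<subseteq> V" for W
      using sum_add_indicator_pair[of W a b w] abne finite_subset[OF that assms(1)] uw ab(3)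
      by (metis (no_types, lifting) sum.cong)
    have "nu E w + 1 \<le> nu E u" using nu_add_edge[OF less.prems(1) ne e(1), of w] uw by presburger
    moreover obtain W1 where W1: "W1 \<subseteq> V" "\<forall>e\<in>E. e \<inter> W1 \<noteq> {}" "sum w W1 \<le> nu E w"
      using less.hyps[of E w] less.prems su[of V] abV by auto
    ultimately have s1: "sum u W1 \<le> nu E u + 1" using su[of W1] by simp
    have "card (E - {e}) < card E" using less.prems(1) e(1) by (rule card_Diff1_less)
    then have "card (E - {e}) + sum u V < card E + sum u V" by simp
    moreover have "finite (E - {e})" "\<Union>(E - {e}) \<subseteq> V"
      "\<And>f. f \<in> E - {e} \<Longrightarrow> \<exists>a\<in>A. \<exists>b\<in>B. f = {a, b}"
      using less.prems by auto
    ultimately obtain W2 where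
      W2: "W2 \<subseteq> V" "\<forall>f\<in>E - {e}. f \<inter> W2 \<noteq> {}" "sum u W2 \<le> nu (E - {e}) u"
      using less.hyps[of "E - {e}" u] by blast
    have s2: "sum u W2 \<le> nu E u"
      using W2(3) nu_subset[OF less.prems(1) ne, of "E - {e}" u] by auto
    show ?thesis
    \<comment> \<open>If \<open>W1\<close> misses an end of \<open>e\<close>, returning from
      \<open>w\<close> to \<open>u\<close> adds at most one unit instead of two, within the bound
      \<open>nu E u\<close>; if \<open>W2\<close> meets \<open>e\<close>, it covers all of
      \<open>E\<close>.\<close>
    proof (cases "e \<inter> W1 \<subseteq> {a} \<or> e \<inter> W1 \<subseteq> {b} \<or> e \<inter> W2 \<noteq> {}")
      case True
      then consider "e \<inter> W2 \<noteq> {}" | "b \<notin> W1" | "a \<notin> W1" using ab(3) abne by blast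
      then show ?thesis
      proof cases
        case 1
        then show ?thesis using W2 s2 by blast
      next
        case 2
        then have "sum u W1 \<le> nu E u"
          using su[OF W1(1)] W1(3) \<open>nu E w + 1 \<le> nu E u\<close> by simp
        then show ?thesis using W1 by blast
      next
        case 3
        then have "sum u W1 \<le> nu E u"
          using su[OF W1(1)] W1(3) \<open>nu E w + 1 \<le> nu E u\<close> by simp
        then show ?thesis using W1 by blast
      qed
    next
      case False
      then have in1: "a \<in> W1" "b \<in> W1" and e2: "e \<inter> W2 = {}" using ab(3) by auto
      \<comment> \<open>For an edge met by both covers: if its end in \<open>B\<close> lies in
        either cover, that end is in \<open>P\<close>; otherwise both covers contain its end in
        \<open>A\<close>, which is then in \<open>P\<close>. \<open>Q\<close> is the mirror image.
        The edge \<open>e\<close> is covered since both its ends are in \<open>W1\<close>.\<close>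
      define P where "P = (W1 \<inter> W2 \<inter> A) \<union> ((W1 \<union> W2) - A)"
      define Q where "Q = ((W1 \<union> W2) \<inter> A) \<union> ((W1 \<inter> W2) - A)"
      have bA: "b' \<notin> A" if "b' \<in> B" for b' using that assms(4) by auto
      have cov: "f \<inter> P \<noteq> {} \<and> f \<inter> Q \<noteq> {}" if f: "f \<in> E" for f
      proof (cases "f = e")
        case True
        then show ?thesis using in1 ab bA unfolding P_def Q_def by auto
      next
        case False
        then obtain a' b' where f': "f = {a', b'}" "a' \<in> A" "b' \<in> B" "f \<inter> W1 \<noteq> {}" "f \<inter> W2 \<noteq> {}"
          using f less.prems(3) W1(2) W2(2) by (metis DiffI singletonD)
        then show ?thesis using bA[of b'] unfolding P_def Q_def by auto
      qed
      have fin: "finite W1" "finite W2" using W1(1) W2(1) assms(1) finite_subset by auto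
      have "sum u P + sum u Q = sum u W1 + sum u W2"
      proof -
        have fin': "finite (W1 \<inter> W2)" "finite (W1 \<union> W2)" using fin by auto
        have "sum u P = sum u (W1 \<inter> W2 \<inter> A) + sum u ((W1 \<union> W2) - A)"
          "sum u Q = sum u ((W1 \<union> W2) \<inter> A) + sum u ((W1 \<inter> W2) - A)"
          unfolding P_def Q_def using fin by (auto intro!: sum.union_disjoint)
        then show ?thesis
          using sum.union_inter[OF fin, of u] sum.Int_Diff[OF fin'(1), of u A]
            sum.Int_Diff[OF fin'(2), of u A] by linarith
      qed
      then have "sum u P \<le> nu E u \<or> sum u Q \<le> nu E u" using s1 s2 by linarith
      moreover have "P \<subseteq> V" "Q \<subseteq> V" using W1(1) W2(1) unfolding P_def Q_def by auto
      ultimately show ?thesis using cov by blast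
    qed
  qed
qed

text \<open>Changing \<open>u\<close> outside a cover does not change its weight, so by weak duality
  a cover of weight at most \<open>nu E u\<close> keeps bounding \<open>nu\<close> when a vertex
  that it misses is altered.\<close>

lemma bipartite_inert_vertex:
  assumes "finite V" "finite E" "\<Union>E \<subseteq> V" "bipartite_graph V E" "V \<noteq> {}"
  shows "\<exists>i\<in>V. \<forall>m. nu E (u(i := m)) \<le> nu E u"
proof -
  obtain A B where AB: "A \<union> B = V" "A \<inter> B = {}" "\<And>e. e \<in> E \<Longrightarrow> \<exists>a\<in>A. \<exists>b\<in>B. e = {a, b}"
    using assms(4) unfolding bipartite_graph_def by metis
  have ne: "{} \<notin> E" using AB(3) by blast
  have *: ?thesis if W: "W \<subseteq> V" "\<forall>e\<in>E. e \<inter> W \<noteq> {}" "sum u W \<le> nu E u" "i \<in> V - W" for W i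
  proof -
    have "nu E (u(i := m)) \<le> nu E u" for m
    proof -
      have "nu E (u(i := m)) \<le> sum (u(i := m)) W"
        using W(1,2) assms(1,2) ne by (intro nu_cover) (auto intro: finite_subset)
      also have "\<dots> = sum u W" using W(4) by (intro sum.cong) auto
      finally show ?thesis using W(3) by simp
    qed
    then show ?thesis using W(4) by blast
  qed
  obtain W where W: "W \<subseteq> V" "\<forall>e\<in>E. e \<inter> W \<noteq> {}" "sum u W \<le> nu E u"
    using konig[OF assms(1-3) AB(2,3), of u] by auto
  show ?thesis
  proof (cases "W = V")
    \<comment> \<open>The cover may be all of \<open>V\<close>. Each side of the bipartition is then
      a cover of no larger weight, and as \<open>V\<close> is nonempty one of the sides is
      proper.\<close>
    case True
    have le: "sum u A \<le> nu E u" "sum u B \<le> nu E u"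
      using W(3) True AB(1) assms(1) sum_mono2[of V A u] sum_mono2[of V B u] by auto
    show ?thesis
    proof (cases "A = V")
      case True
      then have "B = {}" using AB(1,2) by blast
      then show ?thesis using *[of B] AB(3) assms(5) by force
    next
      case False
      then show ?thesis using *[of A] le(1) AB(1,3) by blast
    qed
  next
    case False
    then show ?thesis using * W by blast
  qed
qed

subsection \<open>Partitions into orthants\<close>

text \<open>Coordinates outside of \<open>V\<close> are unconstrained, so that products of regions over disjoint sets
  of variables are intersections.\<close>

definition cylinder :: "'v set \<Rightarrow> ('v \<Rightarrow> nat) \<times> 'v set \<Rightarrow> ('v \<Rightarrow> nat) set" where
  "cylinder V z = {u. \<forall>v\<in>V. if v \<in> snd z then fst z v \<le> u v else u v = fst z v}"

definition stanley_partition ::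
  "'v set \<Rightarrow> nat \<Rightarrow> ('v \<Rightarrow> nat) set \<Rightarrow> (('v \<Rightarrow> nat) \<times> 'v set) set \<Rightarrow> bool" where
  "stanley_partition V d M D \<longleftrightarrow> finite D \<and> (\<forall>z\<in>D. snd z \<subseteq> V \<and> d \<le> card (snd z)) \<and>
     disjoint_family_on (cylinder V) D \<and> (\<Union>z\<in>D. cylinder V z) = M"

definition partitionable :: "'v set \<Rightarrow> nat \<Rightarrow> ('v \<Rightarrow> nat) set \<Rightarrow> bool" where
  "partitionable V d M \<longleftrightarrow> (\<exists>D. stanley_partition V d M D)"

lemma stanley_partitionD:
  assumes "stanley_partition V d M D"
  shows "finite D" "\<And>z. z \<in> D \<Longrightarrow> snd z \<subseteq> V \<and> d \<le> card (snd z)"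
    and "\<And>u. u \<in> M \<Longrightarrow> \<exists>z\<in>D. u \<in> cylinder V z"
    and "\<And>z u. z \<in> D \<Longrightarrow> u \<in> cylinder V z \<Longrightarrow> u \<in> M"
    and "\<And>y z u. y \<in> D \<Longrightarrow> z \<in> D \<Longrightarrow> u \<in> cylinder V y \<Longrightarrow> u \<in> cylinder V z \<Longrightarrow> y = z"
  using assms unfolding stanley_partition_def disjoint_family_on_def by blast+

text \<open>Distinct pairs can describe the same cylinder, because \<open>fst z\<close> is
  irrelevant outside \<open>V\<close>. Choosing one pair per cylinder reduces disjointness to
  showing that overlapping cylinders coincide.\<close>

lemma partitionableI:
  assumes "finite D" "\<And>z. z \<in> D \<Longrightarrow> snd z \<subseteq> V \<and> d \<le> card (snd z)"
    and "\<And>u. u \<in> M \<Longrightarrow> \<exists>z\<in>D. u \<in> cylinder V z"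
    and "\<And>z u. z \<in> D \<Longrightarrow> u \<in> cylinder V z \<Longrightarrow> u \<in> M"
    and "\<And>y z u. y \<in> D \<Longrightarrow> z \<in> D \<Longrightarrow> u \<in> cylinder V y \<Longrightarrow> u \<in> cylinder V z \<Longrightarrow>
           cylinder V y = cylinder V z"
  shows "partitionable V d M"
proof -
  define r where "r C = (SOME z. z \<in> D \<and> cylinder V z = C)" for C
  have r: "r (cylinder V z) \<in> D \<and> cylinder V (r (cylinder V z)) = cylinder V z" if "z \<in> D" for z
    unfolding r_def by (rule someI_ex) (use that in blast)
  define D' where "D' = (\<lambda>z. r (cylinder V z)) ` D"
  have "finite D'" "D' \<subseteq> D" using assms(1) r by (auto simp: D'_def)
  moreover have "disjoint_family_on (cylinder V) D'"
    unfolding disjoint_family_on_def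
  proof (intro ballI impI, rule ccontr)
    fix y z assume yz: "y \<in> D'" "z \<in> D'" "y \<noteq> z" "cylinder V y \<inter> cylinder V z \<noteq> {}"
    then obtain y' z' where "y = r (cylinder V y')" "y' \<in> D" "z = r (cylinder V z')" "z' \<in> D"
      by (auto simp: D'_def)
    then show False using yz r assms(5) by (metis disjoint_iff)
  qed
  moreover have "(\<Union>z\<in>D'. cylinder V z) = M"
    using assms(3,4) r unfolding D'_def by fastforce
  ultimately show ?thesis unfolding partitionable_def stanley_partition_def using assms(2) by (intro exI[of _ D']) blast
qed

lemma partitionable_empty: "partitionable V d {}"
  by (rule partitionableI[of "{}"]) auto

lemma partitionable_mono:
  assumes "partitionable V d M" "e \<le> d"
  shows "partitionable V e M"
proof -
  obtain D where "stanley_partition V d M D"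
    using assms(1) unfolding partitionable_def by blast
  then have "stanley_partition V e M D"
    unfolding stanley_partition_def using order.trans[OF assms(2)] by blast
  then show ?thesis unfolding partitionable_def by blast
qed

lemma partitionable_Un:
  assumes "partitionable V d M" "partitionable V d N" "M \<inter> N = {}"
  shows "partitionable V d (M \<union> N)"
proof -
  obtain D where "stanley_partition V d M D"
    using assms(1) unfolding partitionable_def by blast
  note D = stanley_partitionD[OF this]
  obtain C where "stanley_partition V d N C"
    using assms(2) unfolding partitionable_def by blast
  note C = stanley_partitionD[OF this]
  show ?thesis
  proof (rule partitionableI[of "D \<union> C"])
    fix y z u assume "y \<in> D \<union> C" "z \<in> D \<union> C" "u \<in> cylinder V y" "u \<in> cylinder V z"
    then have "y = z" using D(4)[of y u] D(4)[of z u] D(5)[of y z u] C(4)[of y u] C(4)[of z u]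
        C(5)[of y z u] assms(3) by blast
    then show "cylinder V y = cylinder V z" by simp
  next
    show "\<exists>z\<in>D \<union> C. u \<in> cylinder V z" if "u \<in> M \<union> N" for u using that D(3) C(3) by blast
  next
    show "snd z \<subseteq> V \<and> d \<le> card (snd z)" if "z \<in> D \<union> C" for z using that D(2) C(2) by blast
  next
    show "u \<in> M \<union> N" if "z \<in> D \<union> C" "u \<in> cylinder V z" for z u using that D(4) C(4) by blast
  qed (simp add: D(1) C(1))
qed

lemma partitionable_UN:
  assumes "finite I" "\<And>i. i \<in> I \<Longrightarrow> partitionable V d (M i)" "disjoint_family_on M I"
  shows "partitionable V d (\<Union>i\<in>I. M i)"
  using assms
proof (induction I rule: finite_induct)
  case (insert i I)
  have "M i \<inter> (\<Union>j\<in>I. M j) = {}" "disjoint_family_on M I"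
    using insert.prems(2) insert.hyps(2) by (auto simp: disjoint_family_on_insert)
  then show ?case using insert.IH insert.prems(1) partitionable_Un[of V d "M i"] by simp
qed (simp add: partitionable_empty)

lemma partitionable_Int:
  assumes "partitionable V d M" "partitionable W e N" "V \<inter> W = {}" "finite V" "finite W"
  shows "partitionable (V \<union> W) (d + e) (M \<inter> N)"
proof -
  obtain D where "stanley_partition V d M D"
    using assms(1) unfolding partitionable_def by blast
  note D = stanley_partitionD[OF this]
  obtain C where "stanley_partition W e N C"
    using assms(2) unfolding partitionable_def by blast
  note C = stanley_partitionD[OF this]
  define g where "g = (\<lambda>(y :: ('a \<Rightarrow> nat) \<times> 'a set, z :: ('a \<Rightarrow> nat) \<times> 'a set).
    (\<lambda>v. if v \<in> V then fst y v else fst z v, snd y \<union> snd z))"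
  have g: "cylinder (V \<union> W) (g (y, z)) = cylinder V y \<inter> cylinder W z" if "y \<in> D" "z \<in> C" for y z
  proof -
    have "snd y \<subseteq> V" "snd z \<subseteq> W" using D(2) C(2) that by auto
    then show ?thesis using assms(3) unfolding g_def cylinder_def by (fastforce split: if_splits)
  qed
  show ?thesis
  proof (rule partitionableI[of "g ` (D \<times> C)"])
    fix x assume "x \<in> g ` (D \<times> C)"
    then obtain y z where yz: "y \<in> D" "z \<in> C" "x = g (y, z)" by auto
    have sub: "snd y \<subseteq> V" "snd z \<subseteq> W" using D(2) C(2) yz by auto
    then have "card (snd y \<union> snd z) = card (snd y) + card (snd z)"
      using assms(3-5) by (intro card_Un_disjoint) (auto intro: finite_subset)
    then show "snd x \<subseteq> V \<union> W \<and> d + e \<le> card (snd x)"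
      using sub D(2)[OF yz(1)] C(2)[OF yz(2)] yz(3) by (auto simp: g_def)
  next
    fix u assume "u \<in> M \<inter> N"
    then obtain y z where "y \<in> D" "z \<in> C" "u \<in> cylinder V y" "u \<in> cylinder W z" using D(3) C(3) by blast
    then show "\<exists>x\<in>g ` (D \<times> C). u \<in> cylinder (V \<union> W) x"
      using g by (intro bexI[of _ "g (y, z)"]) auto
  next
    fix x u assume "x \<in> g ` (D \<times> C)" "u \<in> cylinder (V \<union> W) x"
    then show "u \<in> M \<inter> N" using g D(4) C(4) by auto
  next
    fix x x' u
    assume "x \<in> g ` (D \<times> C)" "x' \<in> g ` (D \<times> C)" "u \<in> cylinder (V \<union> W) x" "u \<in> cylinder (V \<union> W) x'"
    then have "x = x'" using g D(5) C(5) by (smt (verit, del_insts) IntE SigmaE image_iff)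
    then show "cylinder (V \<union> W) x = cylinder (V \<union> W) x'" by simp
  qed (use D(1) C(1) in auto)
qed

text \<open>Multiplication by the monomial with exponent \<open>s\<close>; the bound
  \<open>s v \<le> u v\<close> keeps the truncated subtraction honest.\<close>

lemma partitionable_shift:
  assumes "partitionable V d M"
  shows "partitionable V d {u. (\<forall>v\<in>V. s v \<le> u v) \<and> (\<lambda>v. u v - s v) \<in> M}"
proof -
  obtain D where "stanley_partition V d M D"
    using assms(1) unfolding partitionable_def by blast
  note D = stanley_partitionD[OF this]
  define g where "g = (\<lambda>z :: ('a \<Rightarrow> nat) \<times> 'a set. (\<lambda>v. fst z v + s v, snd z))"
  have g: "u \<in> cylinder V (g z) \<longleftrightarrow> (\<forall>v\<in>V. s v \<le> u v) \<and> (\<lambda>v. u v - s v) \<in> cylinder V z" for u z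
  proof -
    have "(if v \<in> snd z then fst z v + s v \<le> u v else u v = fst z v + s v) \<longleftrightarrow>
      s v \<le> u v \<and> (if v \<in> snd z then fst z v \<le> u v - s v else u v - s v = fst z v)" for v
      by auto
    then show ?thesis unfolding g_def cylinder_def by (simp only: mem_Collect_eq fst_conv snd_conv) blast
  qed
  show ?thesis
  proof (rule partitionableI[of "g ` D"])
    fix x x' u
    assume "x \<in> g ` D" "x' \<in> g ` D" "u \<in> cylinder V x" "u \<in> cylinder V x'"
    moreover from this obtain z z' where z: "z \<in> D" "x = g z" "z' \<in> D" "x' = g z'" by blast
    ultimately have "z = z'" using D(5)[of z z' "\<lambda>v. u v - s v"] g by simp
    then show "cylinder V x = cylinder V x'" using z by simp
  next
    fix u assume "u \<in> {u. (\<forall>v\<in>V. s v \<le> u v) \<and> (\<lambda>v. u v - s v) \<in> M}"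
    moreover from this obtain z where "z \<in> D" "(\<lambda>v. u v - s v) \<in> cylinder V z" using D(3) by blast
    ultimately show "\<exists>z\<in>g ` D. u \<in> cylinder V z" using g by (intro bexI[of _ "g z"]) auto
  next
    fix z u assume "z \<in> g ` D" "u \<in> cylinder V z"
    moreover from this obtain y where "y \<in> D" "z = g y" by blast
    ultimately show "u \<in> {u. (\<forall>v\<in>V. s v \<le> u v) \<and> (\<lambda>v. u v - s v) \<in> M}"
      using g[of u y] D(4)[of y "\<lambda>v. u v - s v"] by simp
  next
    fix z assume "z \<in> g ` D"
    then obtain y where "y \<in> D" "z = g y" by blast
    then show "snd z \<subseteq> V \<and> d \<le> card (snd z)" using D(2)[of y] by (simp add: g_def)
  qed (simp add: D(1))
qed

text \<open>The finitely many vectors with entries at most \<open>N\<close> serve as corners: an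
  entry \<open>N\<close> stands for all values from \<open>N\<close> on and becomes a free
  direction, a smaller entry is exact.\<close>

lemma partitionable_truncated:
  assumes "finite V" and tr: "\<And>u w. (\<And>v. v \<in> V \<Longrightarrow> min (u v) N = min (w v) N) \<Longrightarrow> u \<in> M \<Longrightarrow> w \<in> M"
  shows "partitionable V 0 M"
proof -
  define D where "D = (\<lambda>c. (c, {v \<in> V. c v = N})) ` ((V \<rightarrow>\<^sub>E {..N}) \<inter> M)"
  have cyl: "u \<in> cylinder V z \<longleftrightarrow> fst z = (\<lambda>v\<in>V. min (u v) N)" if "z \<in> D" for u z
  proof -
    obtain c where c: "z = (c, {v \<in> V. c v = N})" "c \<in> V \<rightarrow>\<^sub>E {..N}" using \<open>z \<in> D\<close> unfolding D_def by blast
    have "(if c v = N then c v \<le> u v else u v = c v) \<longleftrightarrow> c v = min (u v) N" if "v \<in> V" for v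
      using PiE_mem[OF c(2) that] by (auto simp: min_def)
    moreover have "c v = undefined" if "v \<notin> V" for v using c(2) that by (rule PiE_arb)
    ultimately have "c = (\<lambda>v\<in>V. min (u v) N) \<longleftrightarrow> (\<forall>v\<in>V. if c v = N then c v \<le> u v else u v = c v)"
      by (auto simp: fun_eq_iff restrict_def)
    then show ?thesis unfolding c(1) cylinder_def by simp
  qed
  show ?thesis
  proof (rule partitionableI[of D])
    have "finite (V \<rightarrow>\<^sub>E {..N})" using assms(1) by (intro finite_PiE) auto
    then show "finite D" unfolding D_def by auto
  next
    fix u assume u: "u \<in> M"
    define t where "t = (\<lambda>v\<in>V. min (u v) N)"
    have "t \<in> M" using tr[OF _ u, of t] by (simp add: t_def)
    moreover have "t \<in> V \<rightarrow>\<^sub>E {..N}" by (auto simp: t_def)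
    ultimately have "(t, {v \<in> V. t v = N}) \<in> D" unfolding D_def by blast
    then show "\<exists>z\<in>D. u \<in> cylinder V z" using cyl t_def by force
  next
    fix z u assume z: "z \<in> D" and u: "u \<in> cylinder V z"
    have "fst z \<in> M" using z by (auto simp: D_def)
    then show "u \<in> M" using tr[of "fst z" u] cyl[OF z] u by simp
  next
    fix y z u assume "y \<in> D" "z \<in> D" "u \<in> cylinder V y" "u \<in> cylinder V z"
    moreover from this have "fst y = fst z" using cyl by simp
    ultimately show "cylinder V y = cylinder V z" by (auto simp: D_def)
  qed (auto simp: D_def)
qed

text \<open>As in the truncated partition, but direction \<open>i\<close> is always free. Only those
  corners are kept that are lowest in \<open>M\<close> on their line in direction \<open>i\<close>;
  upward closure fills in the rest of the line.\<close>

lemma partitionable_ray: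
  assumes "finite V" "i \<in> V"
    and tr: "\<And>u w. (\<And>v. v \<in> V \<Longrightarrow> min (u v) N = min (w v) N) \<Longrightarrow> u \<in> M \<Longrightarrow> w \<in> M"
    and up: "\<And>u m. u \<in> M \<Longrightarrow> u i \<le> m \<Longrightarrow> u(i := m) \<in> M"
  shows "partitionable V 1 M"
proof -
  define D where "D = (\<lambda>c. (c, {v \<in> V. c v = N \<or> v = i})) `
    {c \<in> V \<rightarrow>\<^sub>E {..N}. c \<in> M \<and> (c i = 0 \<or> c(i := c i - 1) \<notin> M)}"
  show ?thesis
  proof (rule partitionableI[of D])
    have "finite (V \<rightarrow>\<^sub>E {..N})" using assms(1) by (intro finite_PiE) auto
    then show "finite D" unfolding D_def by auto
  next
    fix z assume "z \<in> D"
    then have "i \<in> snd z" "snd z \<subseteq> V" using assms(2) by (auto simp: D_def)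
    then show "snd z \<subseteq> V \<and> 1 \<le> card (snd z)"
      using assms(1) by (metis One_nat_def Suc_leI card_gt_0_iff empty_iff finite_subset)
  next
    fix u assume u: "u \<in> M"
    define t where "t = (\<lambda>v\<in>V. min (u v) N)"
    have t: "t \<in> M" using tr[OF _ u, of t] by (simp add: t_def)
    define m where "m = (LEAST m. t(i := m) \<in> M)"
    have m: "t(i := m) \<in> M" unfolding m_def by (rule LeastI[of _ "t i"]) (use t in simp)
    have mt: "m \<le> t i" unfolding m_def by (rule Least_le) (use t in simp)
    have "m = 0 \<or> t(i := m - 1) \<notin> M"
      using not_less_Least[of "m - 1" "\<lambda>m. t(i := m) \<in> M"] unfolding m_def[symmetric] by auto
    moreover have "t(i := m) \<in> V \<rightarrow>\<^sub>E {..N}"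
      using assms(2) mt by (auto simp: t_def PiE_def extensional_def)
    ultimately have "(t(i := m), {v \<in> V. (t(i := m)) v = N \<or> v = i}) \<in> D"
      using m unfolding D_def by (intro image_eqI[of _ _ "t(i := m)"]) auto
    moreover have "u \<in> cylinder V (t(i := m), {v \<in> V. (t(i := m)) v = N \<or> v = i})"
      using mt assms(2) by (auto simp: cylinder_def t_def)
    ultimately show "\<exists>z\<in>D. u \<in> cylinder V z" by blast
  next
    fix z u assume "z \<in> D" and u: "u \<in> cylinder V z"
    then obtain c where c: "z = (c, {v \<in> V. c v = N \<or> v = i})" "c \<in> V \<rightarrow>\<^sub>E {..N}" "c \<in> M"
      by (auto simp: D_def)
    have "c(i := u i) \<in> M" using up[OF c(3)] u assms(2) c(1) by (auto simp: cylinder_def)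
    moreover have "min ((c(i := u i)) v) N = min (u v) N" if "v \<in> V" for v
    proof -
      have "c v \<le> N" "if c v = N \<or> v = i then c v \<le> u v else u v = c v"
        using u that c(1,2) by (auto simp: cylinder_def)
      then show ?thesis by (auto split: if_splits)
    qed
    ultimately show "u \<in> M" using tr by blast
  next
    fix y z u assume y: "y \<in> D" and z: "z \<in> D" and u: "u \<in> cylinder V y" "u \<in> cylinder V z"
    obtain c where c: "y = (c, {v \<in> V. c v = N \<or> v = i})" "c \<in> V \<rightarrow>\<^sub>E {..N}" "c \<in> M"
      "c i = 0 \<or> c(i := c i - 1) \<notin> M"
      using y by (auto simp: D_def)
    obtain d where d: "z = (d, {v \<in> V. d v = N \<or> v = i})" "d \<in> V \<rightarrow>\<^sub>E {..N}" "d \<in> M"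
      "d i = 0 \<or> d(i := d i - 1) \<notin> M"
      using z by (auto simp: D_def)
    have *: "c v = min (u v) N" "d v = min (u v) N" if "v \<in> V" "v \<noteq> i" for v
    proof -
      have "c v \<le> N" "d v \<le> N" using that c(2) d(2) by auto
      then show "c v = min (u v) N" "d v = min (u v) N"
        using u that c(1) d(1) by (auto simp: cylinder_def split: if_splits)
    qed
    have cd: "c(i := d i) = d" "d(i := c i) = c"
      using * c(2) d(2) by (auto simp: fun_eq_iff PiE_def extensional_def) metis+
    \<comment> \<open>Both corners lie on one line in direction \<open>i\<close>; if they differed,
      upward closure from the lower one would put the predecessor of the higher one into
      \<open>M\<close>.\<close>
    have "c i = d i"
    proof (rule linorder_cases)
      assume "c i < d i"
      then have "c(i := d i - 1) \<in> M" using up[OF c(3)] by auto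
      then have "d(i := d i - 1) \<in> M" using cd(1) by (metis fun_upd_upd)
      then show ?thesis using d(4) \<open>c i < d i\<close> by auto
    next
      assume "d i < c i"
      then have "d(i := c i - 1) \<in> M" using up[OF d(3)] by auto
      then have "c(i := c i - 1) \<in> M" using cd(2) by (metis fun_upd_upd)
      then show ?thesis using c(4) \<open>d i < c i\<close> by auto
    qed
    then have "c = d" using cd(1) by (metis fun_upd_triv)
    then show "cylinder V y = cylinder V z" using c(1) d(1) by simp
  qed
qed

text \<open>Each \<open>u\<close> in \<open>M\<close> moves in the first direction \<open>i\<close> with \<open>u \<in> G i\<close>. Because each \<open>G i\<close> is a
  down-set, this direction does not change along the ray.\<close>

lemma partitionable_rays:
  assumes "finite V" "finite S" "S \<subseteq> V"
    and trM: "\<And>u w. (\<And>v. v \<in> V \<Longrightarrow> min (u v) N = min (w v) N) \<Longrightarrow> u \<in> M \<Longrightarrow> w \<in> M"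
    and trG: "\<And>i u w. i \<in> S \<Longrightarrow> (\<And>v. v \<in> V \<Longrightarrow> min (u v) N = min (w v) N) \<Longrightarrow> u \<in> G i \<Longrightarrow> w \<in> G i"
    and up: "\<And>i u m. i \<in> S \<Longrightarrow> u \<in> M \<inter> G i \<Longrightarrow> u i \<le> m \<Longrightarrow> u(i := m) \<in> M \<inter> G i"
    and down: "\<And>i u w. i \<in> S \<Longrightarrow> w \<in> G i \<Longrightarrow> (\<And>v. u v \<le> w v) \<Longrightarrow> u \<in> G i"
  shows "partitionable V 1 (M \<inter> (\<Union>i\<in>S. G i))"
  using assms(2,3) trG up down
proof (induction S rule: finite_induct)
  case (insert i S)
  let ?U = "\<Union>j\<in>S. G j"
  have IH: "partitionable V 1 (M \<inter> ?U)"
  proof (rule insert.IH)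
    show "w \<in> G j"
      if "j \<in> S" "\<And>v. v \<in> V \<Longrightarrow> min (u v) N = min (w v) N" "u \<in> G j" for j u w
      using insert.prems(2)[of j u w] that by blast
    show "u(j := m) \<in> M \<inter> G j" if "j \<in> S" "u \<in> M \<inter> G j" "u j \<le> m" for j u m
      using insert.prems(3)[of j u m] that by blast
    show "u \<in> G j" if "j \<in> S" "w \<in> G j" "\<And>v. u v \<le> w v" for j u w
      using insert.prems(4)[of j w u] that by blast
  qed (use insert.prems(1) in blast)
  have "partitionable V 1 (M \<inter> G i - ?U)"
  proof (rule partitionable_ray[OF assms(1), of i N])
    fix u w assume *: "\<And>v. v \<in> V \<Longrightarrow> min (u v) N = min (w v) N" and "u \<in> M \<inter> G i - ?U"
    moreover have "u \<in> G j" if "j \<in> S" "w \<in> G j" for j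
      using insert.prems(2)[of j w u] * that by auto
    ultimately show "w \<in> M \<inter> G i - ?U" using trM[OF *] insert.prems(2)[of i u w] by auto
  next
    fix u m assume u: "u \<in> M \<inter> G i - ?U" and le: "u i \<le> m"
    have "u \<in> G j" if "j \<in> S" "u(i := m) \<in> G j" for j
      using insert.prems(4)[OF _ that(2), of u] le that(1) by auto
    then show "u(i := m) \<in> M \<inter> G i - ?U" using insert.prems(3)[of i u m] u le by blast
  qed (use insert.prems(1) in auto)
  then have "partitionable V 1 ((M \<inter> ?U) \<union> (M \<inter> G i - ?U))"
    by (intro partitionable_Un IH) auto
  moreover have "(M \<inter> ?U) \<union> (M \<inter> G i - ?U) = M \<inter> (\<Union>j\<in>insert i S. G j)" by auto
  ultimately show ?case by simp
qed (simp add: partitionable_empty)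

subsection \<open>Level sets of the matching number\<close>

definition edges_on :: "'v set \<Rightarrow> 'v set set \<Rightarrow> bool" where
  "edges_on V E \<longleftrightarrow> finite V \<and> \<Union>E \<subseteq> V \<and> {} \<notin> E"

lemma edges_onD:
  assumes "edges_on V E"
  shows "finite V" "finite E" "{} \<notin> E" "\<Union>E \<subseteq> V"
  using assms finite_UnionD finite_subset unfolding edges_on_def by blast+

lemma nu_truncate_on:
  assumes "edges_on V E" "k \<le> N" "\<And>v. v \<in> V \<Longrightarrow> min (u v) N = min (w v) N"
  shows "k \<le> nu E u \<longleftrightarrow> k \<le> nu E w"
  using nu_truncate[OF edges_onD(2,3)[OF assms(1)] assms(2)] edges_onD(4)[OF assms(1)] assms(3)
  by (meson subsetD)

lemma partitionable_nu_ge_0: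
  assumes "edges_on V E"
  shows "partitionable V 0 {u. k \<le> nu E u}"
proof (rule partitionable_truncated[of _ k])
  fix u w assume "\<And>v. v \<in> V \<Longrightarrow> min (u v) k = min (w v) k" "u \<in> {u. k \<le> nu E u}"
  then show "w \<in> {u. k \<le> nu E u}" using nu_truncate_on[OF assms, of k k u w] by auto
qed (use edges_onD(1)[OF assms] in simp)

lemma partitionable_nu_eq_0:
  assumes "edges_on V E"
  shows "partitionable V 0 {u. nu E u = k}"
\<comment> \<open>The exact level is the difference of the up-sets for \<open>k\<close> and
  \<open>Suc k\<close>, so the cut-off has to be \<open>Suc k\<close>.\<close>
proof (rule partitionable_truncated[of _ "Suc k"])
  fix u w assume "\<And>v. v \<in> V \<Longrightarrow> min (u v) (Suc k) = min (w v) (Suc k)" "u \<in> {u. nu E u = k}"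
  then show "w \<in> {u. nu E u = k}"
    using nu_truncate_on[OF assms, of k "Suc k" u w] nu_truncate_on[OF assms, of "Suc k" "Suc k" u w]
    by auto
qed (use edges_onD(1)[OF assms] in simp)

lemma partitionable_nu_ge_1:
  assumes "edges_on V E" "V \<noteq> {}"
  shows "partitionable V 1 {u. k \<le> nu E u}"
proof -
  note E = edges_onD[OF assms(1)]
  obtain i where i: "i \<in> V" using assms(2) by blast
  show ?thesis
  proof (rule partitionable_ray[OF E(1) i, of k])
    fix u w assume "\<And>v. v \<in> V \<Longrightarrow> min (u v) k = min (w v) k" "u \<in> {u. k \<le> nu E u}"
    then show "w \<in> {u. k \<le> nu E u}" using nu_truncate_on[OF assms(1), of k k u w] by auto
  next
    fix u m assume "u \<in> {u. k \<le> nu E u}" "u i \<le> m"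
    moreover from this have "nu E u \<le> nu E (u(i := m))" by (intro nu_mono E) auto
    ultimately show "u(i := m) \<in> {u. k \<le> nu E u}" by simp
  qed
qed

text \<open>No single direction suits the whole level set, but every point of it has an inert
  vertex, so it is covered by the sets \<open>?G i\<close> to which
  \<open>partitionable_rays\<close> applies.\<close>

lemma partitionable_nu_eq_1:
  assumes "edges_on V E" "V \<noteq> {}" "bipartite_graph V E"
  shows "partitionable V 1 {u. nu E u = k}"
proof -
  note E = edges_onD[OF assms(1)]
  let ?M = "{u. nu E u = k}"
  \<comment> \<open>The bound \<open>k\<close> in place of \<open>nu E u\<close> makes this a
    down-set; on the level set it still says that vertex \<open>i\<close> is inert.\<close>
  let ?G = "\<lambda>i. {u. \<forall>m. nu E (u(i := m)) \<le> k}"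
  have tr: "(nu E u \<le> k \<longleftrightarrow> nu E w \<le> k) \<and> (nu E u = k \<longleftrightarrow> nu E w = k)"
    if "\<And>v. v \<in> V \<Longrightarrow> min (u v) (Suc k) = min (w v) (Suc k)" for u w
    using nu_truncate_on[OF assms(1), of k "Suc k" u w]
      nu_truncate_on[OF assms(1), of "Suc k" "Suc k" u w] that by auto
  have "partitionable V 1 (?M \<inter> (\<Union>i\<in>V. ?G i))"
  proof (rule partitionable_rays[OF E(1) E(1) subset_refl, of "Suc k"])
    fix u w assume "\<And>v. v \<in> V \<Longrightarrow> min (u v) (Suc k) = min (w v) (Suc k)" "u \<in> ?M"
    then show "w \<in> ?M" using tr by blast
  next
    fix i u w assume *: "\<And>v. v \<in> V \<Longrightarrow> min (u v) (Suc k) = min (w v) (Suc k)" "u \<in> ?G i"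
    have "nu E (w(i := m)) \<le> k" for m
      using tr[of "u(i := m)" "w(i := m)"] * by simp
    then show "w \<in> ?G i" by simp
  next
    fix i u m assume u: "u \<in> ?M \<inter> ?G i" "u i \<le> m"
    have "nu E u \<le> nu E (u(i := m))" using u(2) by (intro nu_mono E) auto
    then show "u(i := m) \<in> ?M \<inter> ?G i" using u(1) by (auto intro: antisym)
  next
    fix i u w assume w: "w \<in> ?G i" "\<And>v. u v \<le> w v"
    have "nu E (u(i := m)) \<le> nu E (w(i := m))" for m using w(2) by (intro nu_mono E) auto
    then show "u \<in> ?G i" using w(1) order.trans by fast
  qed
  moreover have "?M \<subseteq> (\<Union>i\<in>V. ?G i)"
    using bipartite_inert_vertex[OF E(1,2,4) assms(3,2)] by fastforce
  ultimately show ?thesis by (simp add: Int_absorb2)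
qed

lemma nu_Un_on:
  assumes "edges_on V E" "edges_on W F" "V \<inter> W = {}"
  shows "nu (E \<union> F) u = nu E u + nu F u"
  using edges_onD[OF assms(1)] edges_onD[OF assms(2)] assms(3) by (intro nu_Un) auto

lemma partitionable_nu_eq_Un:
  assumes "edges_on V E" "edges_on W F" "V \<inter> W = {}"
    and "\<And>j. partitionable V d {u. nu E u = j}" "\<And>j. partitionable W e {u. nu F u = j}"
  shows "partitionable (V \<union> W) (d + e) {u. nu (E \<union> F) u = k}"
proof -
  let ?M = "\<lambda>j. {u. nu E u = k - j} \<inter> {u. nu F u = j}"
  have "partitionable (V \<union> W) (d + e) (\<Union>j\<in>{..k}. ?M j)"
  proof (rule partitionable_UN)
    show "disjoint_family_on ?M {..k}" by (auto simp: disjoint_family_on_def)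
  qed (use assms edges_onD(1) in \<open>auto intro!: partitionable_Int\<close>)
  moreover have "(\<Union>j\<in>{..k}. ?M j) = {u. nu (E \<union> F) u = k}"
    by (auto simp: nu_Un_on[OF assms(1-3)])
  ultimately show ?thesis by simp
qed

lemma partitionable_nu_ge_Un:
  assumes "edges_on V E" "edges_on W F" "V \<inter> W = {}"
    and "\<And>j. partitionable V d {u. j \<le> nu E u}"
    and "\<And>j. partitionable W e {u. nu F u = j}" "\<And>j. partitionable W e {u. j \<le> nu F u}"
  shows "partitionable (V \<union> W) (d + e) {u. k \<le> nu (E \<union> F) u}"
proof -
  let ?M = "\<lambda>j. {u. k - j \<le> nu E u} \<inter> {u. nu F u = j}"
  \<comment> \<open>The first factor is everything, written as an up-set so that the hypothesis on
    the first part supplies its dimension \<open>d\<close>.\<close>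
  let ?N = "{u. 0 \<le> nu E u} \<inter> {u. k \<le> nu F u}"
  note Int = partitionable_Int[OF _ _ assms(3) edges_onD(1)[OF assms(1)] edges_onD(1)[OF assms(2)]]
  have "partitionable (V \<union> W) (d + e) (\<Union>j\<in>{..<k}. ?M j)"
  proof (rule partitionable_UN)
    show "disjoint_family_on ?M {..<k}" by (auto simp: disjoint_family_on_def)
    show "partitionable (V \<union> W) (d + e) (?M j)" for j by (intro Int assms)
  qed simp
  moreover have "partitionable (V \<union> W) (d + e) ?N" by (intro Int assms)
  ultimately have "partitionable (V \<union> W) (d + e) ((\<Union>j\<in>{..<k}. ?M j) \<union> ?N)"
    by (rule partitionable_Un) auto
  moreover have "(\<Union>j\<in>{..<k}. ?M j) \<union> ?N = {u. k \<le> nu (E \<union> F) u}"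
    by (auto simp: nu_Un_on[OF assms(1-3)])
  ultimately show ?thesis by simp
qed

section \<open>Leaves, and dimension 2 on the tree\<close>

lemma acyclic_has_leaf:
  assumes "simple_graph V E" "E \<noteq> {}" "\<not> (\<exists>vs. is_cycle E vs)"
  obtains x y where "{x, y} \<in> E" "x \<noteq> y" "\<And>e. e \<in> E \<Longrightarrow> x \<in> e \<Longrightarrow> e = {x, y}"
proof -
  have fin: "finite V" and sub: "\<And>e. e \<in> E \<Longrightarrow> e \<subseteq> V" and two: "\<And>e. e \<in> E \<Longrightarrow> card e = 2"
    using assms(1) by (auto simp: simple_graph_def)
  \<comment> \<open>The first vertex of a longest path is a leaf: another neighbour off the path
    would lengthen it, one on the path would close a cycle.\<close>
  define path where "path vs \<longleftrightarrow> 2 \<le> length vs \<and> distinct vs \<and> set vs \<subseteq> V \<and>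
    (\<forall>i. Suc i < length vs \<longrightarrow> {vs ! i, vs ! Suc i} \<in> E)" for vs
  obtain e a b where "e \<in> E" "e = {a, b}" "a \<noteq> b" using assms(2) two by (metis card_2_iff ex_in_conv)
  then have "path [a, b]" using sub by (auto simp: path_def)
  moreover have "length vs < Suc (card V)" if "path vs" for vs
    using that fin by (metis card_mono distinct_card less_Suc_eq_le path_def)
  ultimately obtain vs where vs: "path vs" "\<And>ws. path ws \<Longrightarrow> length ws \<le> length vs"
    using ex_has_greatest_nat[of path "[a, b]" length "Suc (card V)"] by (metis less_imp_le)
  obtain x y zs where xy: "vs = x # y # zs"
    using vs(1) unfolding path_def by (metis One_nat_def Suc_1 Suc_le_length_iff)
  have edge: "{x, y} \<in> E" using vs(1) xy unfolding path_def by force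
  have ne: "x \<noteq> y" using vs(1) xy unfolding path_def by auto
  have "e = {x, y}" if e: "e \<in> E" "x \<in> e" for e
  proof (rule ccontr)
    assume "e \<noteq> {x, y}"
    then obtain z where z: "e = {x, z}" "z \<noteq> x" "z \<noteq> y"
      using two[OF e(1)] e(2) by (metis card_2_iff insertE insert_commute singletonD)
    show False
    proof (cases "z \<in> set vs")
      case False
      have "path (z # vs)"
        unfolding path_def
      proof (intro conjI allI impI)
        fix i assume i: "Suc i < length (z # vs)"
        show "{(z # vs) ! i, (z # vs) ! Suc i} \<in> E"
        proof (cases i)
          case 0
          then show ?thesis using e(1) z(1) xy by (simp add: insert_commute)
        next
          case (Suc j)
          then show ?thesis using i vs(1) by (simp add: path_def)
        qed
      qed (use vs(1) False sub[OF e(1)] z(1) in \<open>auto simp: path_def\<close>)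
      then show False using vs(2)[of "z # vs"] by simp
    next
      case True
      then obtain i where i: "i < length vs" "vs ! i = z" by (auto simp: in_set_conv_nth)
      \<comment> \<open>As \<open>z\<close> is neither \<open>x\<close> nor \<open>y\<close>, the
        prefix ending at \<open>z\<close> has at least the three vertices that a cycle
        requires.\<close>
      have "i \<noteq> 0" "i \<noteq> 1" using i(2) z xy by (metis nth_Cons_0, metis One_nat_def nth_Cons_0 nth_Cons_Suc)
      then have i2: "2 \<le> i" by linarith
      have "is_cycle E (take (Suc i) vs)"
        unfolding is_cycle_def
      proof (intro conjI allI impI)
        fix j assume j: "j < length (take (Suc i) vs)"
        show "{take (Suc i) vs ! j, take (Suc i) vs ! (Suc j mod length (take (Suc i) vs))} \<in> E"
        proof (cases "j = i")
          case True
          have "take (Suc i) vs ! i = z" "length (take (Suc i) vs) = Suc i" using i by simp_all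
          moreover have "take (Suc i) vs ! 0 = x" using xy by simp
          ultimately show ?thesis using True e(1) z(1) by (simp add: insert_commute)
        next
          case False
          then have "j < i" using j by simp
          then show ?thesis using i vs(1) by (simp add: path_def)
        qed
      qed (use i i2 vs(1) in \<open>auto simp: path_def\<close>)
      then show False using assms(3) by blast
    qed
  qed
  then show ?thesis using that edge ne by blast
qed

lemma partitionable_UNIV: "finite V \<Longrightarrow> partitionable V (card V) UNIV"
  by (rule partitionableI[of "{(\<lambda>_. 0, V)}"]) (auto simp: cylinder_def)

text \<open>Only acyclicity is carried through the induction, since it passes to every subgraph. The
  last hypothesis is there because for \<open>k = 0\<close> the region is the whole space, of
  dimension \<open>card V\<close>.\<close>

lemma partitionable_forest:
  fixes V :: "'v set"
  assumes "simple_graph V E" "\<not> (\<exists>vs. is_cycle E vs)" "k \<noteq> 0 \<or> 2 \<le> card V"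
  shows "partitionable V 2 {u. k \<le> nu E u}"
  using assms
proof (induction "card V + k" arbitrary: V E k rule: less_induct)
  case less
  have on: "edges_on V E"
    using less.prems(1) unfolding simple_graph_def edges_on_def by fastforce
  note E = edges_onD[OF on]
  consider "k = 0" | "k \<noteq> 0" "E = {}" | "k \<noteq> 0" "E \<noteq> {}" by blast
  then show ?case
  proof cases
    case 1
    then show ?thesis using less.prems(3) partitionable_mono[OF partitionable_UNIV[OF E(1)]] by simp
  next
    case 2
    then have "nu E u = 0" for u using nu_cover[OF E(2,3), of "{}" u] by simp
    then show ?thesis using 2 by (simp add: partitionable_empty)
  next
    case 3
    obtain x y where xy: "{x, y} \<in> E" "x \<noteq> y" "\<And>e. e \<in> E \<Longrightarrow> x \<in> e \<Longrightarrow> e = {x, y}"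
      using acyclic_has_leaf[OF less.prems(1) 3(2) less.prems(2)] by metis
    have xyV: "x \<in> V" "y \<in> V" using xy(1) E(4) by auto
    define Ex where "Ex = {e \<in> E. x \<notin> e}"
    define Ey where "Ey = {e \<in> E. y \<notin> e}"
    define A where "A = {u. 1 \<le> u x \<and> 1 \<le> u y \<and> k \<le> nu E u}"
    define B where "B = {u. u x = 0} \<inter> {u. k \<le> nu Ex u}"
    \<comment> \<open>Without \<open>y\<close> the leaf \<open>x\<close> is isolated, so its
      exponent is a free direction; the second dimension comes from the up-set on the remaining
      vertices, without induction.\<close>
    define C where "C = {u. 1 \<le> u x} \<inter> ({u. u y = 0} \<inter> {u. k \<le> nu Ey u})"
    have "partitionable V 2 A"
    proof -
      \<comment> \<open>Two vertices are present, which secures the side condition of the induction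
        hypothesis even if \<open>k - 1 = 0\<close>.\<close>
      have "card {x, y} \<le> card V" using xyV E(1) by (intro card_mono) auto
      then have "partitionable V 2 {u. k - 1 \<le> nu E u}"
        using xy(2) 3(1) less.prems by (intro less.hyps) auto
      note partitionable_shift[OF this, of "\<lambda>v. of_bool (v \<in> {x, y})"]
      moreover have "(\<forall>v\<in>V. of_bool (v \<in> {x, y}) \<le> u v) \<longleftrightarrow> 1 \<le> u x \<and> 1 \<le> u y"
        for u :: "'v \<Rightarrow> nat"
        using xyV by auto
      moreover have "k - 1 \<le> nu E (\<lambda>v. u v - of_bool (v \<in> {x, y})) \<longleftrightarrow> k \<le> nu E u"
        if "1 \<le> u x" "1 \<le> u y" for u
      proof -
        have "(\<lambda>v. u v - of_bool (v \<in> {x, y}) + of_bool (v \<in> {x, y})) = u" using that by auto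
        then show ?thesis
          using nu_leaf_edge[OF E(2,3) xy(1,3), of "\<lambda>v. u v - of_bool (v \<in> {x, y})"] 3(1) by auto
      qed
      then have "A = {u. (\<forall>v\<in>V. of_bool (v \<in> {x, y}) \<le> u v) \<and>
          (\<lambda>v. u v - of_bool (v \<in> {x, y})) \<in> {u. k - 1 \<le> nu E u}}"
        unfolding A_def calculation(2) by auto
      ultimately show ?thesis by simp
    qed
    moreover have "partitionable V 2 B"
    proof -
      have "partitionable {x} 0 {u. u x = 0}"
        by (rule partitionableI[of "{(\<lambda>_. 0, {})}"]) (auto simp: cylinder_def)
      moreover have "partitionable (V - {x}) 2 {u. k \<le> nu Ex u}"
      proof (rule less.hyps)
        show "card (V - {x}) + k < card V + k"
          using xyV(1) E(1) by (simp add: card_Diff1_less del: card_Diff_insert)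
        show "simple_graph (V - {x}) Ex"
          using less.prems(1) by (auto simp: simple_graph_def Ex_def)
        show "\<not> (\<exists>vs. is_cycle Ex vs)"
          using less.prems(2) by (auto simp: is_cycle_def Ex_def)
      qed (use 3 in simp)
      ultimately have "partitionable ({x} \<union> (V - {x})) (0 + 2) B"
        unfolding B_def using E(1) by (intro partitionable_Int) auto
      moreover have "{x} \<union> (V - {x}) = V" using xyV(1) by auto
      ultimately show ?thesis by (simp add: numeral_2_eq_2)
    qed
    moreover have "partitionable V 2 C"
    proof -
      have px: "partitionable {x} 1 {u. 1 \<le> u x}"
        by (rule partitionableI[of "{(\<lambda>_. 1, {x})}"]) (auto simp: cylinder_def)
      have py: "partitionable {y} 0 {u. u y = 0}"
        by (rule partitionableI[of "{(\<lambda>_. 0, {})}"]) (auto simp: cylinder_def)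
      have Ey: "edges_on (V - {x, y}) Ey"
        using on xy(3) unfolding edges_on_def Ey_def by blast
      have "partitionable (V - {x, y}) 1 {u. k \<le> nu Ey u}"
      proof (cases "V - {x, y} = {}")
        case True
        \<comment> \<open>No vertices remain, hence no edges, and the region is empty because
          \<open>k\<close> is positive.\<close>
        have "nu Ey u = 0" for u
          using nu_cover[OF edges_onD(2,3)[OF Ey], of "{}" u] edges_onD(3,4)[OF Ey] True by fastforce
        then show ?thesis using 3(1) by (simp add: partitionable_empty)
      next
        case False
        then show ?thesis using Ey by (intro partitionable_nu_ge_1)
      qed
      from partitionable_Int[OF py this]
      have "partitionable ({y} \<union> (V - {x, y})) (0 + 1) ({u. u y = 0} \<inter> {u. k \<le> nu Ey u})"
        using E(1) by auto
      from partitionable_Int[OF px this]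
      have "partitionable ({x} \<union> ({y} \<union> (V - {x, y}))) (1 + (0 + 1)) C"
        unfolding C_def using E(1) xy(2) by auto
      moreover have "{x} \<union> ({y} \<union> (V - {x, y})) = V" using xyV by auto
      ultimately show ?thesis by (simp add: numeral_2_eq_2)
    qed
    moreover have "A \<inter> B = {}" "(A \<union> B) \<inter> C = {}" by (auto simp: A_def B_def C_def)
    ultimately have "partitionable V 2 (A \<union> B \<union> C)" by (intro partitionable_Un)
    moreover have "u \<in> A \<union> B \<union> C \<longleftrightarrow> k \<le> nu E u" for u
      using nu_delete_vertex[OF E(2,3), of u x] nu_delete_vertex[OF E(2,3), of u y]
      unfolding A_def B_def C_def Ex_def[symmetric] Ey_def[symmetric]
      by (cases "u x = 0"; cases "u y = 0") auto
    then have "A \<union> B \<union> C = {u. k \<le> nu E u}" by blast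
    ultimately show ?thesis by simp
  qed
qed

section \<open>Assembling the connected components\<close>

lemma edges_on_induced:
  assumes "finite W" "{} \<notin> E"
  shows "edges_on W (induced_edges W E)"
  using assms by (auto simp: edges_on_def induced_edges_def)

lemma induced_edges_Un:
  assumes "\<And>e. e \<in> E \<Longrightarrow> e \<subseteq> C \<or> e \<inter> C = {}"
  shows "induced_edges (C \<union> W) E = induced_edges C E \<union> induced_edges W E"
  using assms unfolding induced_edges_def by blast

text \<open>Each bipartite component adds one dimension, the leftover vertices \<open>N\<close>
  none. Levels and up-sets are treated together because \<open>partitionable_nu_ge_Un\<close> asks
  for both on its second part.\<close>

lemma partitionable_bipartite_parts:
  assumes "finite \<C>" "finite N" "{} \<notin> E" "disjoint \<C>" "N \<inter> \<Union>\<C> = {}"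
    and "\<And>C. C \<in> \<C> \<Longrightarrow> finite C \<and> C \<noteq> {} \<and> bipartite_graph C (induced_edges C E)"
    and "\<And>C e. C \<in> \<C> \<Longrightarrow> e \<in> E \<Longrightarrow> e \<subseteq> C \<or> e \<inter> C = {}"
  shows "partitionable (N \<union> \<Union>\<C>) (card \<C>) {u. nu (induced_edges (N \<union> \<Union>\<C>) E) u = k}"
    and "partitionable (N \<union> \<Union>\<C>) (card \<C>) {u. k \<le> nu (induced_edges (N \<union> \<Union>\<C>) E) u}"
  using assms(1,4-7)
proof (induction \<C> arbitrary: k rule: finite_induct)
  case empty
  { case 1 show ?case using partitionable_nu_eq_0[OF edges_on_induced[OF assms(2,3)]] by simp }
  { case 2 show ?case using partitionable_nu_ge_0[OF edges_on_induced[OF assms(2,3)]] by simp }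
next
  case (insert C \<C>)
  let ?W = "N \<union> \<Union>\<C>"
  have step: "partitionable (N \<union> \<Union>(insert C \<C>)) (card (insert C \<C>))
       {u. nu (induced_edges (N \<union> \<Union>(insert C \<C>)) E) u = j} \<and>
     partitionable (N \<union> \<Union>(insert C \<C>)) (card (insert C \<C>))
       {u. j \<le> nu (induced_edges (N \<union> \<Union>(insert C \<C>)) E) u}"
    if dis: "disjoint (insert C \<C>)" and N: "N \<inter> \<Union>(insert C \<C>) = {}"
      and bip: "\<And>C'. C' \<in> insert C \<C> \<Longrightarrow>
        finite C' \<and> C' \<noteq> {} \<and> bipartite_graph C' (induced_edges C' E)"
      and closed: "\<And>C' e. C' \<in> insert C \<C> \<Longrightarrow> e \<in> E \<Longrightarrow> e \<subseteq> C' \<or> e \<inter> C' = {}" for j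
  proof -
    have prems: "disjoint \<C>" "N \<inter> \<Union>\<C> = {}"
      "\<And>C'. C' \<in> \<C> \<Longrightarrow> finite C' \<and> C' \<noteq> {} \<and> bipartite_graph C' (induced_edges C' E)"
      "\<And>C' e. C' \<in> \<C> \<Longrightarrow> e \<in> E \<Longrightarrow> e \<subseteq> C' \<or> e \<inter> C' = {}"
      using dis N bip closed by (auto simp: pairwise_insert)
    have "finite ?W" using assms(2) insert.hyps(1) prems(3) by auto
    then have on: "edges_on C (induced_edges C E)" "edges_on ?W (induced_edges ?W E)"
      using bip[of C] assms(3) by (auto intro!: edges_on_induced)
    have CW: "C \<inter> ?W = {}"
      using dis N insert.hyps(2) by (auto simp: pairwise_insert disjnt_def)
    have "induced_edges (C \<union> ?W) E = induced_edges C E \<union> induced_edges ?W E"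
      using closed by (intro induced_edges_Un) blast
    moreover have "N \<union> \<Union>(insert C \<C>) = C \<union> ?W" "card (insert C \<C>) = 1 + card \<C>"
      using insert.hyps by auto
    moreover have "partitionable (C \<union> ?W) (1 + card \<C>)
        {u. nu (induced_edges C E \<union> induced_edges ?W E) u = j}"
      by (rule partitionable_nu_eq_Un[OF on CW partitionable_nu_eq_1[OF on(1)] insert.IH(1)[OF prems]])
        (use bip in auto)
    moreover have "partitionable (C \<union> ?W) (1 + card \<C>)
        {u. j \<le> nu (induced_edges C E \<union> induced_edges ?W E) u}"
      by (rule partitionable_nu_ge_Un[OF on CW partitionable_nu_ge_1[OF on(1)] insert.IH[OF prems]])
        (use bip in auto)
    ultimately show ?thesis by simp
  qed
  { case 1 show ?case using step[OF 1] by blast }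
  { case 2 show ?case using step[OF 2] by blast }
qed

lemma components_props:
  fixes E :: "'v set set"
  assumes "simple_graph UNIV E"
  shows "disjoint (components UNIV E)"
    and "C \<in> components UNIV E \<Longrightarrow> C \<noteq> {}"
    and "C \<in> components UNIV E \<Longrightarrow> e \<in> E \<Longrightarrow> e \<subseteq> C \<or> e \<inter> C = {}"
proof -
  define r where "r = {(u, w). u \<in> (UNIV :: 'v set) \<and> w \<in> (UNIV :: 'v set) \<and> (u, w) \<in> (adj E)\<^sup>*}"
  have "sym (adj E)" by (auto simp: adj_def sym_def insert_commute)
  then have "sym ((adj E)\<^sup>*)" by (rule sym_rtrancl)
  then have eq: "equiv UNIV r"
    unfolding r_def equiv_def refl_on_def trans_def sym_def by auto
  have comp: "components UNIV E = UNIV // r" by (simp add: components_def r_def)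
  show "disjoint (components UNIV E)"
    unfolding comp pairwise_def disjnt_def using quotient_disj[OF eq] by blast
  show "C \<noteq> {}" if "C \<in> components UNIV E" using that in_quotient_imp_non_empty[OF eq] comp by blast
  show "e \<subseteq> C \<or> e \<inter> C = {}" if C: "C \<in> components UNIV E" and e: "e \<in> E"
  proof -
    have "b \<in> C" if "a \<in> e" "a \<in> C" "b \<in> e" for a b
    proof (cases "a = b")
      case False
      have "card e = 2" using assms e by (simp add: simple_graph_def)
      then have "e = {a, b}" using that False by (auto simp: card_2_iff)
      then have "(a, b) \<in> r" using e by (auto simp: r_def adj_def)
      then show ?thesis using in_quotient_imp_closed[OF eq] C that(2) comp by blast
    qed (use that in simp)
    then show ?thesis by blast
  qed
qed

lemma partitionable_edge_power:
  fixes E :: "'v::finite set set"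
  assumes "simple_graph UNIV E"
    and "T \<in> components UNIV E" "tree_graph T (induced_edges T E)" "induced_edges T E \<noteq> {}"
  shows "partitionable UNIV
    (card {C \<in> components UNIV E. bipartite_graph C (induced_edges C E)} + 1) {u. k \<le> nu E u}"
proof -
  have ne: "{} \<notin> E" using assms(1) by (auto simp: simple_graph_def)
  define \<B> where "\<B> = {C \<in> components UNIV E. bipartite_graph C (induced_edges C E)}"
  define \<C> where "\<C> = \<B> - {T}"
  \<comment> \<open>Everything outside the tree; \<open>W - \<Union>\<C>\<close> holds the vertices
    of the other, non-bipartite components.\<close>
  define W where "W = - T"
  note comp = components_props[OF assms(1)]
  have "disjoint \<C>"
    using comp(1) unfolding \<C>_def \<B>_def by (rule pairwise_subset) auto
  have CW: "\<Union>\<C> \<subseteq> W"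
  proof
    fix v assume "v \<in> \<Union>\<C>"
    then obtain C where "C \<in> components UNIV E" "C \<noteq> T" "v \<in> C" by (auto simp: \<C>_def \<B>_def)
    then show "v \<in> W" using pairwiseD[OF comp(1) _ assms(2)] by (auto simp: W_def disjnt_def)
  qed
  then have W: "(W - \<Union>\<C>) \<union> \<Union>\<C> = W" by blast
  have bip: "finite C \<and> C \<noteq> {} \<and> bipartite_graph C (induced_edges C E)" if "C \<in> \<C>" for C
    using that comp(2) by (auto simp: \<C>_def \<B>_def)
  have closed: "e \<subseteq> C \<or> e \<inter> C = {}" if "C \<in> \<C>" "e \<in> E" for C e
    using that comp(3)[of C e] by (auto simp: \<C>_def \<B>_def)
  have N: "(W - \<Union>\<C>) \<inter> \<Union>\<C> = {}" by blast
  note parts = partitionable_bipartite_parts[OF finite finite ne \<open>disjoint \<C>\<close> N bip closed, unfolded W]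
  have sT: "simple_graph T (induced_edges T E)"
    using assms(1) by (auto simp: simple_graph_def induced_edges_def)
  obtain e where "e \<subseteq> T" "card e = 2" using assms(4) sT by (auto simp: simple_graph_def)
  then have "2 \<le> card T" using card_mono[OF finite, of e T] by simp
  then have "partitionable T 2 {u. j \<le> nu (induced_edges T E) u}" for j
    using partitionable_forest[OF sT] assms(3) by (simp add: tree_graph_def)
  then have "partitionable (T \<union> W) (2 + card \<C>) {u. k \<le> nu (induced_edges T E \<union> induced_edges W E) u}"
    using parts ne by (intro partitionable_nu_ge_Un edges_on_induced) (auto simp: W_def)
  moreover have "induced_edges T E \<union> induced_edges W E = E"
    using comp(3)[OF assms(2)] by (auto simp: induced_edges_def W_def)
  moreover have "T \<union> W = UNIV" by (auto simp: W_def)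
  \<comment> \<open>An inequality only, which spares the proof that the tree \<open>T\<close> is bipartite.\<close>
  moreover have "card \<B> + 1 \<le> 2 + card \<C>"
    unfolding \<C>_def using diff_card_le_card_Diff[of "{T}" \<B>] by simp
  ultimately show ?thesis using partitionable_mono unfolding \<B>_def by metis
qed

subsection \<open>Monomial ideals and Stanley decompositions\<close>

definition monomial_span :: "('v \<Rightarrow>\<^sub>0 nat) set \<Rightarrow> ('v, 'k::field) mpoly set" where
  "monomial_span S = {f. Poly_Mapping.keys f \<subseteq> S}"

abbreviation monom :: "('v \<Rightarrow>\<^sub>0 nat) \<Rightarrow> ('v, 'k::field) mpoly" where
  "monom b \<equiv> Poly_Mapping.single b 1"

lemma poly_mapping_sum_single:
  fixes f :: "'a \<Rightarrow>\<^sub>0 'b::comm_monoid_add"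
  shows "(\<Sum>b\<in>Poly_Mapping.keys f. Poly_Mapping.single b (Poly_Mapping.lookup f b)) = f"
proof (rule poly_mapping_eqI)
  fix k
  have "(\<Sum>b\<in>Poly_Mapping.keys f. Poly_Mapping.lookup f b when b = k) = Poly_Mapping.lookup f k"
    by (simp add: when_def in_keys_iff)
  then show "Poly_Mapping.lookup
      (\<Sum>b\<in>Poly_Mapping.keys f. Poly_Mapping.single b (Poly_Mapping.lookup f b)) k = Poly_Mapping.lookup f k"
    by (simp add: lookup_sum lookup_single)
qed

lemma module_mult: "module ((*) :: 'a::comm_ring_1 \<Rightarrow> 'a \<Rightarrow> 'a)"
  by unfold_locales (auto simp: algebra_simps)

text \<open>Closure of \<open>S\<close> under adding exponents makes the span an ideal; conversely
  each term of a polynomial in the span is a multiple of some element of \<open>B\<close>.\<close>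

lemma ideal_gen_eq_monomial_span:
  fixes B :: "('v, 'k::field) mpoly set"
  assumes "B \<subseteq> monomial_span S" "\<And>a b. b \<in> S \<Longrightarrow> a + b \<in> S"
    and "\<And>b. b \<in> S \<Longrightarrow> \<exists>a. \<exists>f\<in>B. monom b = monom a * f"
  shows "ideal_gen B = monomial_span S"
proof -
  interpret m: module "(*) :: ('v, 'k) mpoly \<Rightarrow> _" by (rule module_mult)
  have "m.subspace (monomial_span S)"
  proof (rule m.subspaceI)
    fix x y :: "('v, 'k) mpoly" assume "x \<in> monomial_span S" "y \<in> monomial_span S"
    then show "x + y \<in> monomial_span S"
      using keys_add[of x y] by (auto simp: monomial_span_def)
  next
    fix c x :: "('v, 'k) mpoly" assume "x \<in> monomial_span S"
    then show "c * x \<in> monomial_span S"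
      using keys_mult[of c x] assms(2) by (fastforce simp: monomial_span_def)
  qed (simp add: monomial_span_def)
  then have "ideal_gen B \<subseteq> monomial_span S"
    unfolding ideal_gen_def by (intro m.span_minimal assms(1))
  moreover have "f \<in> ideal_gen B" if f: "f \<in> monomial_span S" for f
  proof -
    have "Poly_Mapping.single b (Poly_Mapping.lookup f b) \<in> ideal_gen B"
      if "b \<in> Poly_Mapping.keys f" for b
    proof -
      have "b \<in> S" using that f by (auto simp: monomial_span_def)
      then obtain a g where g: "g \<in> B" "monom b = monom a * g" using assms(3) by blast
      have "Poly_Mapping.single b (Poly_Mapping.lookup f b)
          = Poly_Mapping.single 0 (Poly_Mapping.lookup f b) * (monom b :: ('v, 'k) mpoly)"
        by (simp add: mult_single)
      also have "\<dots> \<in> ideal_gen B"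
        unfolding ideal_gen_def g(2) by (intro m.span_scale m.span_base g(1))
      finally show ?thesis .
    qed
    then have "(\<Sum>b\<in>Poly_Mapping.keys f. Poly_Mapping.single b (Poly_Mapping.lookup f b)) \<in> ideal_gen B"
      unfolding ideal_gen_def by (intro m.span_sum)
    then show ?thesis by (simp only: poly_mapping_sum_single)
  qed
  ultimately show ?thesis by blast
qed

section \<open>The monomials in the powers of the edge ideal\<close>

definition power_monomials :: "'v set set \<Rightarrow> nat \<Rightarrow> ('v \<Rightarrow>\<^sub>0 nat) set" where
  "power_monomials E k = {b. k \<le> nu E (Poly_Mapping.lookup b)}"

definition edge_monomial :: "'v \<Rightarrow> 'v \<Rightarrow> 'v \<Rightarrow>\<^sub>0 nat" where
  "edge_monomial i j = Poly_Mapping.single i 1 + Poly_Mapping.single j 1"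

lemma lookup_edge_monomial:
  "i \<noteq> j \<Longrightarrow> Poly_Mapping.lookup (edge_monomial i j) = (\<lambda>v. of_bool (v \<in> {i, j}))"
  by (auto simp: edge_monomial_def lookup_add lookup_single when_def fun_eq_iff)

lemma var_mult_var: "var i * var j = monom (edge_monomial i j)"
  by (simp add: var_def mult_single edge_monomial_def)

context
  fixes E :: "'v set set"
  assumes E: "finite E" "\<And>e. e \<in> E \<Longrightarrow> card e = 2"
begin

lemma edges_nonempty: "{} \<notin> E"
  using E(2) by fastforce

lemma power_monomials_add:
  assumes "a \<in> power_monomials E j" "b \<in> power_monomials E k"
  shows "a + b \<in> power_monomials E (j + k)"
proof -
  have "j + k \<le> nu E (Poly_Mapping.lookup a) + nu E (Poly_Mapping.lookup b)"
    using assms by (simp add: power_monomials_def)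
  also have "\<dots> \<le> nu E (Poly_Mapping.lookup (a + b))"
    using nu_add[OF E(1) edges_nonempty] by (simp add: lookup_add[abs_def])
  finally show ?thesis by (simp add: power_monomials_def)
qed

lemma power_monomials_0: "power_monomials E 0 = UNIV"
  by (simp add: power_monomials_def)

lemma power_monomials_Suc:
  assumes "b \<in> power_monomials E (Suc k)"
  obtains i j c where "{i, j} \<in> E" "i \<noteq> j" "c \<in> power_monomials E k"
    "b = edge_monomial i j + c"
proof -
  let ?u = "Poly_Mapping.lookup b"
  have "Suc k \<le> nu E ?u" using assms by (simp add: power_monomials_def)
  then obtain e where e: "e \<in> E" "\<And>v. v \<in> e \<Longrightarrow> 1 \<le> ?u v" "k \<le> nu E (\<lambda>v. ?u v - of_bool (v \<in> e))"
    using nu_add_edge_cases[OF E(1) edges_nonempty] by metis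
  obtain i j where ij: "e = {i, j}" "i \<noteq> j" using E(2)[OF e(1)] by (auto simp: card_2_iff)
  note look = lookup_edge_monomial[OF ij(2)]
  \<comment> \<open>Subtraction of exponents is truncated; nothing is lost because \<open>b\<close>
    is positive at both ends of \<open>e\<close>.\<close>
  have "b = edge_monomial i j + (b - edge_monomial i j)"
  proof (rule poly_mapping_eqI)
    show "?u v = Poly_Mapping.lookup (edge_monomial i j + (b - edge_monomial i j)) v" for v
      using e(2)[of v] unfolding lookup_add lookup_minus look ij(1) by auto
  qed
  moreover have "Poly_Mapping.lookup (b - edge_monomial i j) = (\<lambda>v. ?u v - of_bool (v \<in> e))"
    by (rule ext, subst lookup_minus, subst look, subst ij(1), rule refl)
  then have "b - edge_monomial i j \<in> power_monomials E k"
    using e(3) by (simp add: power_monomials_def)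
  ultimately show ?thesis using that e(1) ij by metis
qed

lemma edge_in_power_monomials:
  assumes "{i, j} \<in> E"
  shows "edge_monomial i j \<in> power_monomials E 1"
proof -
  have "i \<noteq> j" using E(2)[OF assms] by auto
  then show ?thesis
    using nu_add_edge[OF E(1) edges_nonempty assms, of "\<lambda>_. 0"]
    by (simp add: power_monomials_def lookup_edge_monomial)
qed

lemma edge_ideal_eq_monomial_span:
  "edge_ideal E = (monomial_span (power_monomials E 1) :: ('v, 'k::field) mpoly set)"
  unfolding edge_ideal_def
proof (rule ideal_gen_eq_monomial_span)
  show "{var i * var j |i j. {i, j} \<in> E} \<subseteq> (monomial_span (power_monomials E 1) :: ('v, 'k) mpoly set)"
    using edge_in_power_monomials by (auto simp: monomial_span_def var_mult_var)
next
  fix a b assume "b \<in> power_monomials E 1"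
  then show "a + b \<in> power_monomials E 1"
    using power_monomials_add[of a 0 b 1] by (simp add: power_monomials_0)
next
  fix b assume "b \<in> power_monomials E 1"
  then obtain i j c where "{i, j} \<in> E" "b = edge_monomial i j + c"
    using power_monomials_Suc[of b 0] by (metis One_nat_def)
  then have "var i * var j \<in> {var i * var j |i j. {i, j} \<in> E}"
    "(monom b :: ('v, 'k) mpoly) = monom c * (var i * var j)"
    by (auto simp: var_mult_var mult_single add.commute)
  then show "\<exists>a. \<exists>f\<in>{var i * var j |i j. {i, j} \<in> E}. (monom b :: ('v, 'k) mpoly) = monom a * f"
    by blast
qed

lemma ideal_power_edge_ideal:
  "ideal_power (edge_ideal E) k = (monomial_span (power_monomials E k) :: ('v, 'k::field) mpoly set)"
proof (induction k)
  case 0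
  show ?case by (simp add: monomial_span_def power_monomials_0)
next
  case (Suc k)
  let ?B = "{f * g |f g. f \<in> edge_ideal E \<and> g \<in> ideal_power (edge_ideal E) k} :: ('v, 'k) mpoly set"
  have "ideal_gen ?B = monomial_span (power_monomials E (Suc k))"
  proof (rule ideal_gen_eq_monomial_span)
    show "?B \<subseteq> monomial_span (power_monomials E (Suc k))"
    proof
      fix h assume "h \<in> ?B"
      then obtain f g :: "('v, 'k) mpoly" where "h = f * g" "f \<in> monomial_span (power_monomials E 1)"
        "g \<in> monomial_span (power_monomials E k)"
        unfolding Suc.IH unfolding edge_ideal_eq_monomial_span by blast
      then show "h \<in> monomial_span (power_monomials E (Suc k))"
        using keys_mult[of f g] power_monomials_add[of _ 1 _ k] unfolding monomial_span_def by force
    qed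
  next
    fix a b assume "b \<in> power_monomials E (Suc k)"
    then show "a + b \<in> power_monomials E (Suc k)"
      using power_monomials_add[of a 0 b "Suc k"] by (simp add: power_monomials_0)
  next
    fix b assume "b \<in> power_monomials E (Suc k)"
    then obtain i j c where b: "{i, j} \<in> E" "c \<in> power_monomials E k"
      "b = edge_monomial i j + c"
      using power_monomials_Suc[of b k] by metis
    let ?e = "edge_monomial i j"
    have "(monom ?e :: ('v, 'k) mpoly) \<in> edge_ideal E" "(monom c :: ('v, 'k) mpoly) \<in> ideal_power (edge_ideal E) k"
      unfolding Suc.IH unfolding edge_ideal_eq_monomial_span
      using edge_in_power_monomials[OF b(1)] b(2) by (auto simp: monomial_span_def)
    then have "(monom ?e * monom c :: ('v, 'k) mpoly) \<in> ?B" by blast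
    \<comment> \<open>\<open>monom 0\<close> is the unit: the monomial is itself one of the
      generating products.\<close>
    moreover have "(monom b :: ('v, 'k) mpoly) = monom 0 * (monom ?e * monom c)"
      using b(3) by (simp add: mult_single)
    ultimately show "\<exists>a. \<exists>f\<in>?B. monom b = monom a * f" by blast
  qed
  then show ?case by simp
qed

end

section \<open>From orthants of exponents to Stanley spaces\<close>

lemma lookup_mult_monom:
  fixes f :: "('v, 'k::field) mpoly"
  shows "Poly_Mapping.lookup (f * monom c) (b + c) = Poly_Mapping.lookup f b"
proof -
  have "f * monom c = (\<Sum>a\<in>Poly_Mapping.keys f. Poly_Mapping.single (a + c) (Poly_Mapping.lookup f a))"
    by (subst poly_mapping_sum_single[symmetric, of f]) (simp add: sum_distrib_right mult_single)
  then show ?thesis by (simp add: lookup_sum lookup_single when_def in_keys_iff)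
qed

lemma mult_monom_cancel:
  fixes f g :: "('v, 'k::field) mpoly"
  shows "f * monom c = g * monom c \<Longrightarrow> f = g"
  using lookup_mult_monom by (metis poly_mapping_eqI)

lemma stanley_subspace_monom:
  "stanley_subspace (*) (monom c, Z) =
    (monomial_span {b. Poly_Mapping.lookup b \<in> cylinder UNIV (Poly_Mapping.lookup c, Z)} :: ('v, 'k::field) mpoly set)"
proof (intro set_eqI iffI)
  let ?S = "{b. Poly_Mapping.lookup b \<in> cylinder UNIV (Poly_Mapping.lookup c, Z)}"
  fix g :: "('v, 'k) mpoly"
  {
    assume "g \<in> stanley_subspace (*) (monom c, Z)"
    then obtain f :: "('v, 'k) mpoly" where f: "g = f * monom c" "\<And>b. b \<in> Poly_Mapping.keys f \<Longrightarrow> Poly_Mapping.keys b \<subseteq> Z"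
      by (auto simp: stanley_subspace_def polys_in_def)
    have "b \<in> ?S" if b: "b \<in> Poly_Mapping.keys g" for b
    proof -
      obtain a where "a \<in> Poly_Mapping.keys f" "b = a + c"
        using subsetD[OF keys_mult b[unfolded f(1)]] by auto
      then show ?thesis using f(2)[of a] by (auto simp: cylinder_def lookup_add in_keys_iff)
    qed
    then show "g \<in> monomial_span ?S" by (auto simp: monomial_span_def)
  next
    assume "g \<in> monomial_span ?S"
    then have g: "Poly_Mapping.lookup b \<in> cylinder UNIV (Poly_Mapping.lookup c, Z)"
      if "b \<in> Poly_Mapping.keys g" for b
      using that by (auto simp: monomial_span_def)
    have sub: "b - c + c = b" "Poly_Mapping.keys (b - c) \<subseteq> Z" if "b \<in> Poly_Mapping.keys g" for b
    proof -
      have *: "if v \<in> Z then Poly_Mapping.lookup c v \<le> Poly_Mapping.lookup b v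
          else Poly_Mapping.lookup b v = Poly_Mapping.lookup c v" for v
        using g[OF that] unfolding cylinder_def fst_conv snd_conv by blast
      show "b - c + c = b"
      proof (rule poly_mapping_eqI)
        show "Poly_Mapping.lookup (b - c + c) v = Poly_Mapping.lookup b v" for v
          using *[of v] by (auto simp: lookup_add lookup_minus split: if_splits)
      qed
      show "Poly_Mapping.keys (b - c) \<subseteq> Z"
      proof
        fix v assume "v \<in> Poly_Mapping.keys (b - c)"
        then show "v \<in> Z" using *[of v] by (auto simp: in_keys_iff lookup_minus split: if_splits)
      qed
    qed
    \<comment> \<open>The quotient of \<open>g\<close> by the monomial, formed term by term; every
      exponent of \<open>g\<close> dominates \<open>c\<close>.\<close>
    define f where "f = (\<Sum>b\<in>Poly_Mapping.keys g. Poly_Mapping.single (b - c) (Poly_Mapping.lookup g b))"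
    have "Poly_Mapping.keys f \<subseteq> (\<Union>b\<in>Poly_Mapping.keys g. {b - c})"
      unfolding f_def by (rule order.trans[OF Poly_Mapping.keys_sum]) (auto split: if_splits)
    then have "f \<in> polys_in Z" using sub(2) by (fastforce simp: polys_in_def)
    moreover have "f * monom c = g"
    proof -
      have "f * monom c = (\<Sum>b\<in>Poly_Mapping.keys g. Poly_Mapping.single (b - c + c) (Poly_Mapping.lookup g b))"
        unfolding f_def by (simp add: sum_distrib_right mult_single)
      also have "\<dots> = (\<Sum>b\<in>Poly_Mapping.keys g. Poly_Mapping.single b (Poly_Mapping.lookup g b))"
        using sub(1) by (intro sum.cong) auto
      finally show ?thesis by (simp add: poly_mapping_sum_single)
    qed
    ultimately show "g \<in> stanley_subspace (*) (monom c, Z)"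
      unfolding stanley_subspace_def by (intro image_eqI[of _ _ f]) auto
  }
qed

text \<open>The monomial alone is a basis: multiplication by it is injective, which makes the
  coefficient unique.\<close>

lemma free_over_stanley_subspace_monom:
  "free_over (*) (polys_in Z) (stanley_subspace (*) (monom c :: ('v, 'k::field) mpoly, Z))"
  unfolding free_over_def
proof (intro exI[of _ "{monom c}"] conjI ballI)
  have "1 \<in> (polys_in Z :: ('v, 'k) mpoly set)" by (simp add: polys_in_def)
  then show "{monom c} \<subseteq> stanley_subspace (*) (monom c :: ('v, 'k) mpoly, Z)"
    by (force simp: stanley_subspace_def)
next
  fix m assume "m \<in> stanley_subspace (*) (monom c :: ('v, 'k) mpoly, Z)"
  then obtain f :: "('v, 'k) mpoly" where f: "f \<in> polys_in Z" "m = f * monom c"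
    by (auto simp: stanley_subspace_def)
  let ?P = "\<lambda>d :: ('v, 'k) mpoly \<Rightarrow>\<^sub>0 ('v, 'k) mpoly. Poly_Mapping.keys d \<subseteq> {monom c} \<and>
    range (Poly_Mapping.lookup d) \<subseteq> polys_in Z \<and>
    m = (\<Sum>b\<in>Poly_Mapping.keys d. Poly_Mapping.lookup d b * b)"
  have sum: "(\<Sum>b\<in>Poly_Mapping.keys d. Poly_Mapping.lookup d b * b) = Poly_Mapping.lookup d (monom c) * monom c"
    if "Poly_Mapping.keys d \<subseteq> {monom c}" for d :: "('v, 'k) mpoly \<Rightarrow>\<^sub>0 ('v, 'k) mpoly"
  proof -
    have "(\<Sum>b\<in>Poly_Mapping.keys d. Poly_Mapping.lookup d b * b) = (\<Sum>b\<in>{monom c}. Poly_Mapping.lookup d b * b)"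
      using that by (intro sum.mono_neutral_left) (auto simp: in_keys_iff)
    then show ?thesis by simp
  qed
  show "\<exists>!d. ?P d"
  proof (rule ex1I[of _ "Poly_Mapping.single (monom c) f"])
    have "0 \<in> (polys_in Z :: ('v, 'k) mpoly set)" by (simp add: polys_in_def)
    then have "range (Poly_Mapping.lookup (Poly_Mapping.single (monom c :: ('v, 'k) mpoly) f)) \<subseteq> polys_in Z"
      using f(1) by (auto simp: lookup_single when_def)
    moreover have k: "Poly_Mapping.keys (Poly_Mapping.single (monom c :: ('v, 'k) mpoly) f) \<subseteq> {monom c}"
      by simp
    ultimately show "?P (Poly_Mapping.single (monom c) f)" using sum[OF k] f(2) by simp
  next
    fix d assume d: "?P d"
    then have "f * monom c = Poly_Mapping.lookup d (monom c) * monom c"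
      using f(2) sum[of d] by argo
    then have "f = Poly_Mapping.lookup d (monom c)" by (rule mult_monom_cancel)
    moreover have "Poly_Mapping.lookup d b = 0" if "b \<noteq> monom c" for b
      using d that by (metis in_keys_iff singletonD subsetD)
    ultimately have "Poly_Mapping.lookup d b = Poly_Mapping.lookup (Poly_Mapping.single (monom c) f) b" for b
      by (cases "b = monom c") (simp_all add: lookup_single when_def)
    then show "d = Poly_Mapping.single (monom c) f" by (rule poly_mapping_eqI)
  qed
qed

text \<open>With disjoint sets of exponents, the summand in \<open>N d\<close> can be read off from
  the coefficients at exponents in \<open>T d\<close>.\<close>

lemma bij_betw_monomial_spans:
  fixes N :: "'d \<Rightarrow> ('v, 'k::field) mpoly set"
  assumes "finite D" "disjoint_family_on T D" "\<And>d. d \<in> D \<Longrightarrow> N d = monomial_span (T d)"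
  shows "bij_betw (\<lambda>m. \<Sum>d\<in>D. m d) (Pi\<^sub>E D N) (monomial_span (\<Union>d\<in>D. T d))"
proof -
  have look: "Poly_Mapping.lookup (\<Sum>d\<in>D. m d) b = Poly_Mapping.lookup (m d) b"
    if m: "m \<in> Pi\<^sub>E D N" and d: "d \<in> D" "b \<in> T d" for m d b
  proof -
    have "Poly_Mapping.lookup (m d') b = 0" if "d' \<in> D - {d}" for d'
    proof -
      have "b \<notin> T d'" using assms(2) d that by (auto simp: disjoint_family_on_def)
      moreover have "m d' \<in> monomial_span (T d')" using m that assms(3) by auto
      ultimately show ?thesis by (auto simp: monomial_span_def in_keys_iff)
    qed
    then have "(\<Sum>d'\<in>D - {d}. Poly_Mapping.lookup (m d') b) = 0" by (intro sum.neutral) blast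
    then show ?thesis
      using sum.remove[OF assms(1) d(1), of "\<lambda>d. Poly_Mapping.lookup (m d) b"] by (simp add: lookup_sum)
  qed
  show ?thesis
    unfolding bij_betw_def
  proof (intro conjI inj_onI set_eqI iffI)
    fix m n assume mn: "m \<in> Pi\<^sub>E D N" "n \<in> Pi\<^sub>E D N" "(\<Sum>d\<in>D. m d) = (\<Sum>d\<in>D. n d)"
    show "m = n"
    proof (rule PiE_ext[OF mn(1,2)], rule poly_mapping_eqI)
      fix d b assume d: "d \<in> D"
      have "m d \<in> monomial_span (T d)" "n d \<in> monomial_span (T d)" using mn(1,2) d assms(3) by auto
      then show "Poly_Mapping.lookup (m d) b = Poly_Mapping.lookup (n d) b"
      proof (cases "b \<in> T d")
        case True
        then show ?thesis using look[OF mn(1) d True] look[OF mn(2) d True] mn(3) by simp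
      next
        case False
        then have "b \<notin> Poly_Mapping.keys (m d)" "b \<notin> Poly_Mapping.keys (n d)"
          using \<open>m d \<in> _\<close> \<open>n d \<in> _\<close> by (auto simp: monomial_span_def)
        then show ?thesis by (simp add: in_keys_iff)
      qed
    qed
  next
    fix f assume "f \<in> (\<lambda>m. \<Sum>d\<in>D. m d) ` Pi\<^sub>E D N"
    then obtain m where m: "m \<in> Pi\<^sub>E D N" "f = (\<Sum>d\<in>D. m d)" by blast
    have "Poly_Mapping.keys f \<subseteq> (\<Union>d\<in>D. Poly_Mapping.keys (m d))"
      unfolding m(2) by (rule Poly_Mapping.keys_sum)
    moreover have "Poly_Mapping.keys (m d) \<subseteq> T d" if "d \<in> D" for d
      using m(1) assms(3)[OF that] that by (auto simp: monomial_span_def)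
    ultimately show "f \<in> monomial_span (\<Union>d\<in>D. T d)" by (fastforce simp: monomial_span_def)
  next
    fix f :: "('v, 'k) mpoly" assume f: "f \<in> monomial_span (\<Union>d\<in>D. T d)"
    define r where "r d = (\<Sum>b\<in>Poly_Mapping.keys f \<inter> T d. Poly_Mapping.single b (Poly_Mapping.lookup f b))"
      for d
    define m where "m = restrict r D"
    have "Poly_Mapping.keys (r d) \<subseteq> T d" for d
      unfolding r_def by (rule order.trans[OF Poly_Mapping.keys_sum]) (auto split: if_splits)
    then have "m \<in> Pi\<^sub>E D N"
      using assms(3) by (auto simp: m_def monomial_span_def)
    moreover have "f = (\<Sum>d\<in>D. m d)"
    proof -
      have "Poly_Mapping.keys f = (\<Union>d\<in>D. Poly_Mapping.keys f \<inter> T d)"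
        using f by (auto simp: monomial_span_def)
      then have "f = (\<Sum>b\<in>(\<Union>d\<in>D. Poly_Mapping.keys f \<inter> T d). Poly_Mapping.single b (Poly_Mapping.lookup f b))"
        using poly_mapping_sum_single[of f] by simp
      also have "\<dots> = (\<Sum>d\<in>D. m d)"
        using assms(1,2)
        by (subst sum.UNION_disjoint) (auto simp: m_def r_def disjoint_family_on_def intro!: sum.cong)
      finally show ?thesis .
    qed
    ultimately show "f \<in> (\<lambda>m. \<Sum>d\<in>D. m d) ` Pi\<^sub>E D N" by blast
  qed
qed

lemma sdepth_ge_partitionable:
  fixes M :: "('v::finite \<Rightarrow> nat) set"
  assumes "partitionable UNIV d M" "M \<noteq> {}"
  shows "d \<le> sdepth (*) poly_component
    (monomial_span {b. Poly_Mapping.lookup b \<in> M} :: ('v, 'k::field) mpoly set)"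
proof -
  let ?I = "monomial_span {b. Poly_Mapping.lookup b \<in> M} :: ('v, 'k) mpoly set"
  obtain D where "stanley_partition UNIV d M D" using assms(1) unfolding partitionable_def by blast
  note D = stanley_partitionD[OF this]
  define mon where "mon z = (monom (Abs_poly_mapping (fst z)) :: ('v, 'k) mpoly, snd z)"
    for z :: "('v \<Rightarrow> nat) \<times> 'v set"
  \<comment> \<open>There are finitely many variables, so every function is an exponent
    vector.\<close>
  have look: "Poly_Mapping.lookup (Abs_poly_mapping c) = c" for c :: "'v \<Rightarrow> nat" by simp
  have "inj mon"
  proof (rule injI)
    fix y z assume "mon y = mon z"
    then have eq: "(monom (Abs_poly_mapping (fst y)) :: ('v, 'k) mpoly) = monom (Abs_poly_mapping (fst z))"
      "snd y = snd z"
      by (auto simp: mon_def)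
    from arg_cong[OF eq(1), of Poly_Mapping.keys]
    have "Abs_poly_mapping (fst y) = Abs_poly_mapping (fst z)" by simp
    then show "y = z" using look eq(2) by (metis prod_eqI)
  qed
  then have inv: "inv mon (mon z) = z" for z by simp
  define T where "T d = {b. Poly_Mapping.lookup b \<in> cylinder UNIV (inv mon d)}" for d
  have space: "stanley_subspace (*) (mon z) = monomial_span (T (mon z))" for z
  proof -
    have "stanley_subspace (*) (mon z) = monomial_span {b. Poly_Mapping.lookup b \<in> cylinder UNIV z}"
      unfolding mon_def stanley_subspace_monom look prod.collapse ..
    then show ?thesis by (simp add: T_def inv)
  qed
  have "disjoint_family_on T (mon ` D)"
    unfolding disjoint_family_on_def
  proof (intro ballI impI, rule ccontr)
    fix d e assume "d \<in> mon ` D" "e \<in> mon ` D" "d \<noteq> e" "T d \<inter> T e \<noteq> {}"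
    then obtain y z b where *: "y \<in> D" "z \<in> D" "mon y \<noteq> mon z" "b \<in> T (mon y)" "b \<in> T (mon z)"
      by blast
    then show False using D(5)[of y z "Poly_Mapping.lookup b"] by (simp add: T_def inv)
  qed
  then have "bij_betw (\<lambda>m. \<Sum>d\<in>mon ` D. m d) (Pi\<^sub>E (mon ` D) (stanley_subspace (*)))
      (monomial_span (\<Union>d\<in>mon ` D. T d))"
    using D(1) space by (intro bij_betw_monomial_spans) auto
  moreover have "(\<Union>d\<in>mon ` D. T d) = {b. Poly_Mapping.lookup b \<in> M}"
    using D(3,4) unfolding T_def by (simp add: inv) blast
  moreover have "is_stanley_space (*) poly_component ?I (mon z)" if "z \<in> D" for z
  proof -
    have "fst z \<in> cylinder UNIV z" by (simp add: cylinder_def)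
    then have "fst z \<in> M" using D(4) that by blast
    then have "fst (mon z) \<in> ?I" by (simp add: mon_def monomial_span_def)
    moreover have "fst (mon z) \<in> poly_component (\<lambda>i. int (fst z i))"
      by (simp add: mon_def poly_component_def)
    ultimately show ?thesis
      unfolding is_stanley_space_def using free_over_stanley_subspace_monom by (auto simp: mon_def)
  qed
  ultimately have dec: "stanley_decomposition (*) poly_component ?I (mon ` D)"
    using D(1) by (auto simp: stanley_decomposition_def)
  have "D \<noteq> {}" using assms(2) D(3) by blast
  then have "d \<le> sdepth_decomposition (mon ` D)"
    using D(1,2) unfolding sdepth_decomposition_def by (subst Min_ge_iff) (auto simp: mon_def)
  also have "\<dots> \<le> sdepth (*) poly_component ?I"
    unfolding sdepth_def
  proof (rule Max_ge)
    \<comment> \<open>\<open>Max\<close> needs a bounded set of depths. The ideal contains a nonzero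
      monomial, so no decomposition is empty and each minimum is at most the number of
      variables.\<close>
    have "sdepth_decomposition X \<le> card (UNIV :: 'v set)"
      if X: "stanley_decomposition (*) poly_component ?I X" for X
    proof -
      obtain u where "u \<in> M" using assms(2) by blast
      then have "monom (Abs_poly_mapping u) \<in> ?I" by (simp add: monomial_span_def)
      moreover have "monom (Abs_poly_mapping u) \<noteq> (0 :: ('v, 'k) mpoly)"
        by (metis keys_single keys_zero insert_not_empty one_neq_zero)
      ultimately have "X \<noteq> {}"
        using X by (auto simp: stanley_decomposition_def bij_betw_def)
      then obtain x where "x \<in> X" by blast
      moreover have "finite X" using X by (simp add: stanley_decomposition_def)
      ultimately have "sdepth_decomposition X \<le> card (snd x)"
        unfolding sdepth_decomposition_def by (intro Min_le) auto
      also have "\<dots> \<le> card (UNIV :: 'v set)" by (intro card_mono) auto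
      finally show ?thesis .
    qed
    then show "finite (sdepth_decomposition ` {X. stanley_decomposition (*) poly_component ?I X})"
      by (intro finite_subset[OF _ finite_atMost[of "card (UNIV :: 'v set)"]]) auto
  qed (use dec in blast)
  finally show ?thesis .
qed

theorem corollary3p5:
  fixes E :: "'v::finite set set"
    and I :: "('v, 'k::field) mpoly set"
    and p k :: nat
  assumes "simple_graph UNIV E"
    and "I = edge_ideal E"
    and "p = card {C \<in> components UNIV E. bipartite_graph C (induced_edges C E)}"
    and "\<exists>C \<in> components UNIV E. tree_graph C (induced_edges C E) \<and> induced_edges C E \<noteq> {}"
    and "k \<ge> 1"
  shows "sdepth (*) poly_component (ideal_power I k) \<ge> p + 1"
proof -
  have E: "finite E" "\<And>e. e \<in> E \<Longrightarrow> card e = 2"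
    using assms(1) by (auto simp: simple_graph_def)
  obtain T where T: "T \<in> components UNIV E" "tree_graph T (induced_edges T E)" "induced_edges T E \<noteq> {}"
    using assms(4) by blast
  then obtain e where "e \<in> E" by (auto simp: induced_edges_def)
  \<comment> \<open>The power is nonzero: it contains the \<open>k\<close>-th power of the monomial
    of \<open>e\<close>.\<close>
  have "\<exists>u. k \<le> nu E u"
  proof (induction k)
    case (Suc k)
    then obtain u where "k \<le> nu E u" by blast
    then have "Suc k \<le> nu E (\<lambda>v. u v + of_bool (v \<in> e))"
      using nu_add_edge[OF E(1) edges_nonempty[OF E] \<open>e \<in> E\<close>, of u] by linarith
    then show ?case by blast
  qed simp
  then have "p + 1 \<le> sdepth (*) poly_component
      (monomial_span {b. Poly_Mapping.lookup b \<in> {u. k \<le> nu E u}} :: ('v, 'k) mpoly set)"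
    unfolding assms(3) using sdepth_ge_partitionable[OF partitionable_edge_power[OF assms(1) T]] by blast
  moreover have "ideal_power I k = monomial_span (power_monomials E k)"
    using ideal_power_edge_ideal[OF E] assms(2) by simp
  ultimately show ?thesis by (simp add: power_monomials_def)
qed

end
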